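(* Suppose $X$ is a complete CAT(0) space. Then $\overline{X}_{\mathrm I}=X\cup\partial_{\mathrm I}X$ equipped with the cone topology and $\overline{X}_{\mathrm B}=X\cup\partial_{\mathrm B}X$ equipped with the bouquet topology are naturally homeomorphic; the natural homeomorphism $\overline{X}_{\mathrm I}\to\overline{X}_{\mathrm B}$ is the identity on $X$ and sends the class of a unit speed geodesic ray $\gamma$ to the class $[(\gamma|_{[0,n]})_{n=1}^\infty]$ of the bouquet of its initial segments.
   Context: Notation: $a\vee b$ is the maximum and $a\wedge b$ the minimum of $a,b$. Rough CAT(0) spaces. An $h$-short segment ($h\ge 0$) from $x$ to $y$ in a metric space $(X,d)$ is a path from $x$ to $y$ of length at most $d(x,y)+h$. $X$ is a length space if every pair of points is joined by an $h$-short segment for every $h>0$. An $h$-short triangle with vertices $x_1,x_2,x_3$ consists of $h$-short segments $[x_i,x_j]_h$ joining the three pairs of vertices (its sides). A comparison triangle is a geodesic triangle $\overline T\subset\mathbb{R}^2$ with vertices $\bar x_i$ such that $|\bar x_i-\bar x_j|=d(x_i,x_j)$. For $u\in[x_i,x_j]_h$, a point $\bar u\in\overline T$ is an $h$-comparison point for $u$ if $|\bar x_i-\bar u|\le \mathrm{len}([x_i,u]_h)$ and $|\bar u-\bar x_j|\le\mathrm{len}([u,x_j]_h)$, where $[x_i,u]_h,[u,x_j]_h$ are the two subpaths of $[x_i,x_j]_h$. For $C>0$, a length space $X$ is $C$-rCAT(0) if for every $h$-short triangle with vertices $x,y,z$ and $h\le H(x,y,z):=1/(1\vee d(x,y)\vee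 d(x,z)\vee d(y,z))$ one has $d(u,v)\le|\bar u-\bar v|+C$ whenever $u,v$ lie on different sides of the triangle and $\bar u,\bar v$ are corresponding $h$-comparison points in a comparison triangle. $X$ is rCAT(0) if it is $C$-rCAT(0) for some $C>0$. Every CAT(0) space is rCAT(0). Bouquets. A short function is a (not necessarily strictly) decreasing function $D:[0,\infty)\to(0,1]$ with $D(t)\le 1/t$ for $t>1$ and $|D(s)-D(t)|\le|s-t|$. A segment (path) from $x$ to $y$ is $D$-short if it is $h$-short for $h=D(d(x,y))$. For $c\ge0$ and a short function $D$, a $(c,D)$-bouquet from $o\in X$ is a sequence $\beta=(\beta_n)_{n=1}^\infty$ of unit speed $D$-short segments $\beta_n:[0,L_n]\to X$ such that $\beta_n(0)=o$ for all $n$, $(L_n)$ is monotonically increasing with limit infinity, and $d(\beta_m(t),\beta_n(t))\le c$ for all $m\le n$ and $0\le t\le L_m$. A bouquet is a $(c,D)$-bouquet for some $c,D$ and some initial point. Bouquets $\beta^1,\beta^2$ (with $\beta^i_n:[0,L^i_n]\to X$) are asymptotic, $\beta^1\sim\beta^2$, if there is $K\ge0$ with $d(\beta^1_m(t),\beta^2_n(t))\le K$ for all $m,n$ and $0\le t\le L^1_m\wedge L^2_n$. The bouquet boundary $\partial_{\mathrm B}X$ is the set of asymptoticity classes $[\beta]$ of bouquets in $X$. Bouquet topology. Fix $o\in X$ and $C>0$ such that $X$ is $C$-rCAT(0), and put $D(t)=1/(1\vee(2t))$, $L_n=(2C+2)^n$. A standard bouquet from $o$ is a $(2C+2,D)$-bouquet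 $\beta=(\beta_n)$ from $o$ with $\beta_n:[0,L_n]\to X$. A mother bouquet from $o$ to $x\in X$ is a $D$-short unit speed path $\gamma:[0,L]\to X$ from $o$ to $x$; its associated finite length bouquet from $o$ to $x$ is $(\beta_n)$ with $\beta_n=\tilde\gamma|_{[0,L_n]}$, where $\tilde\gamma=\gamma$ on $[0,L]$ and $\tilde\gamma(t)=x$ for $t>L$. Let $\mathcal{GB}(X)$ be the set of all standard and all finite length bouquets from $o$. Let $P=\prod_{n=1}^\infty\prod_{0\le t\le L_n}X_n^t$ with the product topology, where each $X_n^t$ is a copy of the closed ball $\{x\in X: d(o,x)\le L_n+1\}$, and view $\mathcal{GB}(X)$ as a subspace of $P$ via $\beta\mapsto(\beta_n(t))_{n,t}$. Let $q:\mathcal{GB}(X)\to\overline{X}_{\mathrm B}:=X\cup\partial_{\mathrm B}X$ send a finite length bouquet from $o$ to $x$ to $x$, and a standard bouquet $\beta$ to $[\beta]$ (this map is surjective). The bouquet topology on $\overline{X}_{\mathrm B}$ is the quotient topology for $q$. Ideal boundary and cone topology. $\partial_{\mathrm I}X$ is the set of equivalence classes of geodesic rays, two rays being equivalent if their unit speed parametrizations $\tilde\gamma_1,\tilde\gamma_2:[0,\infty)\to X$ satisfy $\sup_{t\ge0}d(\tilde\gamma_1(t),\tilde\gamma_2(t))<\infty$. For $X$ complete CAT(0) and fixed $o\in X$, each point of $\partial_{\mathrm I}X$ is represented by a unique unit speed geodesic ray from $o$. For $t>0$ and $y\in\overline{X}_{\mathrm I}\setminus B(o,t)$ let $p_t(y)$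 be the point at distance $t$ from $o$ on the geodesic segment or ray from $o$ to $y$. The cone topology on $\overline{X}_{\mathrm I}$ has neighborhood basis $\{B(x,r):r>0\}$ at $x\in X$ and $\{U(x,r,t):r,t>0\}$ at $x\in\partial_{\mathrm I}X$, where $U(x,r,t)=\{y\in\overline{X}_{\mathrm I}\setminus B(o,t): d(p_t(x),p_t(y))<r\}$. *)

theory Defs
  imports "HOL-Analysis.Analysis"
begin

text \<open>Throughout, the metric space \<open>X\<close> is the universe of a type of class \<open>metric_space\<close>.\<close>

section \<open>Paths and their length\<close>

definition curve_length :: "(real \<Rightarrow> 'a::metric_space) \<Rightarrow> real \<Rightarrow> real \<Rightarrow> ennreal" where
  "curve_length g a b =
     (SUP ts \<in> {ts. sorted ts \<and> set ts \<subseteq> {a..b}}.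
        ennreal (\<Sum>i<length ts - 1. dist (g (ts ! i)) (g (ts ! Suc i))))"

definition short_segment ::
  "real \<Rightarrow> (real \<Rightarrow> 'a::metric_space) \<Rightarrow> real \<Rightarrow> real \<Rightarrow> 'a \<Rightarrow> 'a \<Rightarrow> bool" where
  "short_segment h g a b x y \<longleftrightarrow>
     a \<le> b \<and> continuous_on {a..b} g \<and> g a = x \<and> g b = y \<and>
     curve_length g a b \<le> ennreal (dist x y + h)"

definition unit_speed :: "(real \<Rightarrow> 'a::metric_space) \<Rightarrow> real \<Rightarrow> bool" where
  "unit_speed g L \<longleftrightarrow>
     (\<forall>s t. 0 \<le> s \<and> s \<le> t \<and> t \<le> L \<longrightarrow> curve_length g s t = ennreal (t - s))"

definition length_space :: "'a::metric_space itself \<Rightarrow> bool" where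
  "length_space _ \<longleftrightarrow>
     (\<forall>(x::'a) y. \<forall>h>0. \<exists>g a b. short_segment h g a b x y)"

definition geodesic_segment :: "(real \<Rightarrow> 'a::metric_space) \<Rightarrow> 'a \<Rightarrow> 'a \<Rightarrow> bool" where
  "geodesic_segment g x y \<longleftrightarrow>
     g 0 = x \<and> g (dist x y) = y \<and>
     (\<forall>s\<in>{0..dist x y}. \<forall>t\<in>{0..dist x y}. dist (g s) (g t) = \<bar>s - t\<bar>)"

definition geodesic_space :: "'a::metric_space itself \<Rightarrow> bool" where
  "geodesic_space _ \<longleftrightarrow> (\<forall>(x::'a) y. \<exists>g. geodesic_segment g x y)"

definition geodesic_ray :: "(real \<Rightarrow> 'a::metric_space) \<Rightarrow> bool" where
  "geodesic_ray g \<longleftrightarrow> (\<forall>s\<ge>0. \<forall>t\<ge>0. dist (g s) (g t) = \<bar>s - t\<bar>)"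


section \<open>CAT(0) and rough CAT(0) spaces\<close>

text \<open>
  The vertices of a triangle are indexed by the three-element type \<open>3\<close>, in which addition
  is modulo 3.  Side \<open>k\<close> is the side opposite to vertex \<open>k\<close>, joining the vertices
  \<open>k + 1\<close> and \<open>k + 2\<close>.
\<close>

definition comparison_vertices :: "(3 \<Rightarrow> 'a::metric_space) \<Rightarrow> (3 \<Rightarrow> real^2) \<Rightarrow> bool" where
  "comparison_vertices x xb \<longleftrightarrow> (\<forall>i j. dist (xb i) (xb j) = dist (x i) (x j))"

definition plane_side :: "(3 \<Rightarrow> real^2) \<Rightarrow> 3 \<Rightarrow> (real^2) set" where
  "plane_side xb k = closed_segment (xb (k + 1)) (xb (k + 2))"

definition plane_triangle :: "(3 \<Rightarrow> real^2) \<Rightarrow> (real^2) set" where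
  "plane_triangle xb = (\<Union>k. plane_side xb k)"

definition CAT0 :: "'a::metric_space itself \<Rightarrow> bool" where
  "CAT0 _ \<longleftrightarrow> geodesic_space TYPE('a) \<and>
     (\<forall>(x :: 3 \<Rightarrow> 'a) g xb i j s t ub vb.
        (\<forall>k. geodesic_segment (g k) (x (k + 1)) (x (k + 2))) \<and>
        comparison_vertices x xb \<and>
        s \<in> {0..dist (x (i + 1)) (x (i + 2))} \<and>
        t \<in> {0..dist (x (j + 1)) (x (j + 2))} \<and>
        ub \<in> plane_side xb i \<and> dist (xb (i + 1)) ub = dist (x (i + 1)) (g i s) \<and>
        vb \<in> plane_side xb j \<and> dist (xb (j + 1)) vb = dist (x (j + 1)) (g j t)
        \<longrightarrow> dist (g i s) (g j t) \<le> dist ub vb)"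

definition short_triangle ::
  "real \<Rightarrow> (3 \<Rightarrow> 'a::metric_space) \<Rightarrow> (3 \<Rightarrow> real \<Rightarrow> 'a) \<Rightarrow>
   (3 \<Rightarrow> real) \<Rightarrow> (3 \<Rightarrow> real) \<Rightarrow> bool" where
  "short_triangle h x g a b \<longleftrightarrow>
     (\<forall>k. short_segment h (g k) (a k) (b k) (x (k + 1)) (x (k + 2)))"

text \<open>
  A point on a side of a short triangle is given by its parameter, since the two subpaths into
  which it divides the side depend on the parameter if the side is not injective.  A comparison
  point may be any point of the comparison triangle that satisfies the two inequalities.
\<close>

definition comparison_point ::
  "(3 \<Rightarrow> real \<Rightarrow> 'a::metric_space) \<Rightarrow> (3 \<Rightarrow> real) \<Rightarrow> (3 \<Rightarrow> real) \<Rightarrow>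
   (3 \<Rightarrow> real^2) \<Rightarrow> 3 \<Rightarrow> real \<Rightarrow> real^2 \<Rightarrow> bool" where
  "comparison_point g a b xb k s ub \<longleftrightarrow>
     ub \<in> plane_triangle xb \<and>
     ennreal (dist (xb (k + 1)) ub) \<le> curve_length (g k) (a k) s \<and>
     ennreal (dist ub (xb (k + 2))) \<le> curve_length (g k) s (b k)"

definition rCAT0_bound :: "(3 \<Rightarrow> 'a::metric_space) \<Rightarrow> real" where
  "rCAT0_bound x =
     1 / max 1 (max (dist (x 0) (x 1)) (max (dist (x 0) (x 2)) (dist (x 1) (x 2))))"

definition rCAT0 :: "real \<Rightarrow> 'a::metric_space itself \<Rightarrow> bool" where
  "rCAT0 C _ \<longleftrightarrow> length_space TYPE('a) \<and>
     (\<forall>h (x :: 3 \<Rightarrow> 'a) g a b xb i j s t ub vb.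
        0 \<le> h \<and> h \<le> rCAT0_bound x \<and>
        short_triangle h x g a b \<and> comparison_vertices x xb \<and>
        i \<noteq> j \<and> s \<in> {a i..b i} \<and> t \<in> {a j..b j} \<and>
        comparison_point g a b xb i s ub \<and> comparison_point g a b xb j t vb
        \<longrightarrow> dist (g i s) (g j t) \<le> dist ub vb + C)"


section \<open>Bouquets and the bouquet boundary\<close>

definition short_function :: "(real \<Rightarrow> real) \<Rightarrow> bool" where
  "short_function D \<longleftrightarrow>
     (\<forall>t\<ge>0. 0 < D t \<and> D t \<le> 1) \<and>
     (\<forall>s t. 0 \<le> s \<and> s \<le> t \<longrightarrow> D t \<le> D s) \<and>
     (\<forall>t>1. D t \<le> 1 / t) \<and>
     (\<forall>s\<ge>0. \<forall>t\<ge>0. \<bar>D s - D t\<bar> \<le> \<bar>s - t\<bar>)"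

definition D_short :: "(real \<Rightarrow> real) \<Rightarrow> (real \<Rightarrow> 'a::metric_space) \<Rightarrow> real \<Rightarrow> bool" where
  "D_short D g L \<longleftrightarrow>
     short_segment (D (dist (g 0) (g L))) g 0 L (g 0) (g L)"

text \<open>
  A sequence of paths \<open>\<beta>\<^sub>n : [0, L\<^sub>n] \<rightarrow> X\<close>, \<open>n \<ge> 1\<close>, is a pair \<open>(L, \<beta>)\<close>; the entries for
  \<open>n = 0\<close> and the values of \<open>\<beta>\<^sub>n\<close> outside \<open>[0, L\<^sub>n]\<close> are irrelevant.
\<close>

type_synonym 'a path_seq = "(nat \<Rightarrow> real) \<times> (nat \<Rightarrow> real \<Rightarrow> 'a)"

text \<open>
  \<open>D\<close> is not required to be a short function here, because \<open>std_D\<close> below, with Lipschitz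
  constant 2, is not one.  It is dominated by the short function \<open>t \<mapsto> 1 / max 1 t\<close>,
  so standard bouquets are nevertheless bouquets.
\<close>

definition cD_bouquet ::
  "real \<Rightarrow> (real \<Rightarrow> real) \<Rightarrow> 'a::metric_space \<Rightarrow> 'a path_seq \<Rightarrow> bool" where
  "cD_bouquet c D x0 = (\<lambda>(L, \<beta>).
     (\<forall>n\<ge>1. unit_speed (\<beta> n) (L n) \<and> D_short D (\<beta> n) (L n) \<and> \<beta> n 0 = x0) \<and>
     mono_on {1..} L \<and> filterlim L at_top sequentially \<and>
     (\<forall>m n t. 1 \<le> m \<and> m \<le> n \<and> 0 \<le> t \<and> t \<le> L m
        \<longrightarrow> dist (\<beta> m t) (\<beta> n t) \<le> c))"

definition bouquet :: "'a::metric_space path_seq \<Rightarrow> bool" where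
  "bouquet B \<longleftrightarrow> (\<exists>c D x0. 0 \<le> c \<and> short_function D \<and> cD_bouquet c D x0 B)"

definition bouquet_asymptotic :: "('a::metric_space path_seq \<times> 'a path_seq) set" where
  "bouquet_asymptotic =
     {((L, \<beta>), (L', \<beta>')). bouquet (L, \<beta>) \<and> bouquet (L', \<beta>') \<and>
        (\<exists>K\<ge>0. \<forall>m\<ge>1. \<forall>n\<ge>1. \<forall>t. 0 \<le> t \<and> t \<le> min (L m) (L' n)
           \<longrightarrow> dist (\<beta> m t) (\<beta>' n t) \<le> K)}"

definition bouquet_class :: "'a::metric_space path_seq \<Rightarrow> 'a path_seq set" where
  "bouquet_class B = bouquet_asymptotic `` {B}"

definition bouquet_boundary :: "'a::metric_space path_seq set set" where
  "bouquet_boundary = {B. bouquet B} // bouquet_asymptotic"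

definition bouquet_space :: "('a::metric_space + 'a path_seq set) set" where
  "bouquet_space = UNIV <+> bouquet_boundary"


section \<open>The bouquet topology\<close>

definition std_D :: "real \<Rightarrow> real" where
  "std_D t = 1 / max 1 (2 * t)"

definition std_L :: "real \<Rightarrow> nat \<Rightarrow> real" where
  "std_L C n = (2 * C + 2) ^ n"

definition bouquet_index :: "real \<Rightarrow> (nat \<times> real) set" where
  "bouquet_index C = {(n, t). 1 \<le> n \<and> 0 \<le> t \<and> t \<le> std_L C n}"

definition bouquet_product :: "real \<Rightarrow> 'a::metric_space \<Rightarrow> (nat \<times> real \<Rightarrow> 'a) topology" where
  "bouquet_product C x0 =
     product_topology (\<lambda>(n, t). top_of_set (cball x0 (std_L C n + 1))) (bouquet_index C)"

definition as_path_seq :: "real \<Rightarrow> (nat \<times> real \<Rightarrow> 'a) \<Rightarrow> 'a path_seq" where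
  "as_path_seq C b = (std_L C, \<lambda>n t. b (n, t))"

definition standard_bouquet :: "real \<Rightarrow> 'a::metric_space \<Rightarrow> (nat \<times> real \<Rightarrow> 'a) \<Rightarrow> bool" where
  "standard_bouquet C x0 b \<longleftrightarrow>
     b \<in> extensional (bouquet_index C) \<and>
     cD_bouquet (2 * C + 2) std_D x0 (as_path_seq C b)"

definition mother_bouquet ::
  "'a::metric_space \<Rightarrow> 'a \<Rightarrow> real \<Rightarrow> (real \<Rightarrow> 'a) \<Rightarrow> bool" where
  "mother_bouquet x0 x L g \<longleftrightarrow>
     unit_speed g L \<and> D_short std_D g L \<and> g 0 = x0 \<and> g L = x"

definition finite_length_bouquet ::
  "real \<Rightarrow> 'a::metric_space \<Rightarrow> 'a \<Rightarrow> (nat \<times> real \<Rightarrow> 'a) \<Rightarrow> bool" where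
  "finite_length_bouquet C x0 x b \<longleftrightarrow>
     (\<exists>L g. mother_bouquet x0 x L g \<and>
        b = restrict (\<lambda>(n, t). if t \<le> L then g t else x) (bouquet_index C))"

definition generalized_bouquets :: "real \<Rightarrow> 'a::metric_space \<Rightarrow> (nat \<times> real \<Rightarrow> 'a) set" where
  "generalized_bouquets C x0 =
     {b. standard_bouquet C x0 b \<or> (\<exists>x. finite_length_bouquet C x0 x b)}"

text \<open>
  No \<open>b\<close> is both a standard and a finite length bouquet, and the endpoint of a finite length
  bouquet is unique: if it comes from a path on \<open>[0, L]\<close>, then \<open>b (n, t)\<close> is the endpoint
  for all \<open>t \<ge> L\<close>.
\<close>

definition bouquet_proj ::
  "real \<Rightarrow> 'a::metric_space \<Rightarrow> (nat \<times> real \<Rightarrow> 'a) \<Rightarrow> 'a + 'a path_seq set" where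
  "bouquet_proj C x0 b =
     (if standard_bouquet C x0 b then Inr (bouquet_class (as_path_seq C b))
      else Inl (THE x. finite_length_bouquet C x0 x b))"

definition quotient_topology :: "'a topology \<Rightarrow> ('a \<Rightarrow> 'b) \<Rightarrow> 'b set \<Rightarrow> 'b topology" where
  "quotient_topology T q Y =
     topology (\<lambda>U. U \<subseteq> Y \<and> openin T {a \<in> topspace T. q a \<in> U})"

lemma openin_quotient_topology:
  "openin (quotient_topology T q Y) U \<longleftrightarrow> U \<subseteq> Y \<and> openin T {a \<in> topspace T. q a \<in> U}"
proof -
  let ?P = "\<lambda>U. U \<subseteq> Y \<and> openin T {a \<in> topspace T. q a \<in> U}"
  have "istopology ?P"
    unfolding istopology_def
  proof (intro conjI allI impI)
    fix S S' assume "?P S" "?P S'"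
    moreover have "{a \<in> topspace T. q a \<in> S \<inter> S'} =
        {a \<in> topspace T. q a \<in> S} \<inter> {a \<in> topspace T. q a \<in> S'}" by auto
    ultimately show "S \<inter> S' \<subseteq> Y" "openin T {a \<in> topspace T. q a \<in> S \<inter> S'}" by auto
  next
    fix K assume K: "\<forall>S\<in>K. ?P S"
    have "{a \<in> topspace T. q a \<in> \<Union>K} = (\<Union>S\<in>K. {a \<in> topspace T. q a \<in> S})" by auto
    with K show "openin T {a \<in> topspace T. q a \<in> \<Union>K}" by auto
    from K show "\<Union>K \<subseteq> Y" by auto
  qed
  then show ?thesis
    unfolding quotient_topology_def by (simp add: topology_inverse')
qed

definition bouquet_topology ::
  "real \<Rightarrow> 'a::metric_space \<Rightarrow> ('a + 'a path_seq set) topology" where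
  "bouquet_topology C x0 =
     quotient_topology (subtopology (bouquet_product C x0) (generalized_bouquets C x0))
       (bouquet_proj C x0) bouquet_space"


section \<open>The ideal boundary and the cone topology\<close>

text \<open>As with bouquets, the values of a ray at negative arguments are irrelevant.\<close>

definition ray_equiv :: "((real \<Rightarrow> 'a::metric_space) \<times> (real \<Rightarrow> 'a)) set" where
  "ray_equiv =
     {(g, g'). geodesic_ray g \<and> geodesic_ray g' \<and> bdd_above ((\<lambda>t. dist (g t) (g' t)) ` {0..})}"

definition ray_class :: "(real \<Rightarrow> 'a::metric_space) \<Rightarrow> (real \<Rightarrow> 'a) set" where
  "ray_class g = ray_equiv `` {g}"

definition ideal_boundary :: "(real \<Rightarrow> 'a::metric_space) set set" where
  "ideal_boundary = {g. geodesic_ray g} // ray_equiv"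

definition ideal_space :: "('a::metric_space + (real \<Rightarrow> 'a) set) set" where
  "ideal_space = UNIV <+> ideal_boundary"

definition cone_proj ::
  "'a::metric_space \<Rightarrow> real \<Rightarrow> 'a + (real \<Rightarrow> 'a) set \<Rightarrow> 'a" where
  "cone_proj x0 t y =
     (case y of
        Inl x \<Rightarrow> (THE z. \<exists>g. geodesic_segment g x0 x \<and> z = g t)
      | Inr \<xi> \<Rightarrow> (THE z. \<exists>g\<in>\<xi>. g 0 = x0 \<and> z = g t))"

definition cone_nbhd ::
  "'a::metric_space \<Rightarrow> (real \<Rightarrow> 'a) set \<Rightarrow> real \<Rightarrow> real \<Rightarrow> ('a + (real \<Rightarrow> 'a) set) set" where
  "cone_nbhd x0 \<xi> r t =
     {y \<in> ideal_space - Inl ` ball x0 t.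
        dist (cone_proj x0 t (Inr \<xi>)) (cone_proj x0 t y) < r}"

text \<open>
  A set is open iff it contains a basic neighborhood of each of its points.  In a complete CAT(0)
  space these sets form a topology, because \<open>cone_nbhd x0 \<xi> r t\<close> is antitone in \<open>t\<close>.
\<close>

definition cone_topology ::
  "'a::metric_space \<Rightarrow> ('a + (real \<Rightarrow> 'a) set) topology" where
  "cone_topology x0 =
     topology (\<lambda>U. U \<subseteq> ideal_space \<and>
       (\<forall>x. Inl x \<in> U \<longrightarrow> (\<exists>r>0. Inl ` ball x r \<subseteq> U)) \<and>
       (\<forall>\<xi>. Inr \<xi> \<in> U \<longrightarrow> (\<exists>r>0. \<exists>t>0. cone_nbhd x0 \<xi> r t \<subseteq> U)))"

end

theory Submission
  imports Defs
begin

text \<open>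
  Everything rests on Stewart's inequality for geodesics.  It shows that geodesics issuing from
  a common point contract linearly towards it, and that a \<open>D\<close>-short path stays within distance 2
  of the geodesic with the same endpoints.  Hence the geodesics from the initial point of a
  bouquet to the endpoints of its segments converge to a ray at a distance from the bouquet that
  depends only on the constant of the bouquet.  So every bouquet is asymptotic to a ray, and a
  generalized bouquet over \<open>y\<close> stays uniformly close to the geodesic or ray from the base point
  to \<open>y\<close>.  By contraction, one coordinate of a bouquet at a large parameter then controls the
  point \<open>y\<close> in the cone topology.  Conversely, finitely many coordinates of the bouquet formed by
  the initial segments of the geodesic or ray to \<open>y\<close> depend continuously on \<open>y\<close>.
\<close>

section \<open>Lengths of isometric and of short paths\<close>

text \<open>A generalized bouquet determines its geodesic or ray only up to the bounded error
  \<open>4 * C + 9\<close>, whereas cone neighbourhoods may be arbitrarily small. At a boundary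
  point the contraction factor \<open>t / T\<close> absorbs this error once \<open>T\<close> is
  large. At a point \<open>x\<close> of the space there is no such factor, but the coordinates are
  exact: from parameter \<open>dist p x + 1\<close> on, a finite length bouquet over
  \<open>x\<close> rests at \<open>x\<close>, while any path of a generalized bouquet that is still
  running at \<open>t\<close> is at distance at least \<open>t - 1\<close> from the base point
  \<open>p\<close>. So a late coordinate near \<open>x\<close> can only be the endpoint of a finite
  length bouquet. The quotient topology makes the two directions asymmetric. Openness of the image
  of a cone-open set must be tested at every generalized bouquet over it, which requires bounds
  uniform over all of them. For the converse, one bouquet over each point suffices, provided that it
  depends continuously on the point. Completeness enters through the convergence of geodesics to a
  ray in \<open>exists_limit_ray\<close>.\<close>

lemma dist_le_curve_length:
  assumes "s \<le> t"
  shows "ennreal (dist (g s) (g t)) \<le> curve_length g s t"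
  unfolding curve_length_def
  by (rule SUP_upper2[where i="[s, t]"]) (use assms in auto)

lemma telescope_sorted_le:
  fixes ts :: "real list"
  assumes "sorted ts" "set ts \<subseteq> {s..t}" "s \<le> t"
  shows "(\<Sum>i<length ts - 1. ts ! Suc i - ts ! i) \<le> t - s"
proof (cases "ts = []")
  case False
  have "(\<Sum>i<length ts - 1. ts ! Suc i - ts ! i) = ts ! (length ts - 1) - ts ! 0"
    by (rule sum_lessThan_telescope)
  moreover have "ts ! (length ts - 1) \<in> {s..t}" "ts ! 0 \<in> {s..t}"
    using False by (auto intro!: subsetD[OF assms(2)] nth_mem simp del: atLeastAtMost_iff)
  ultimately show ?thesis by auto
qed (use assms in auto)

text \<open>Unlike in \<open>geodesic_segment\<close>, the length is a parameter of its own, so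
  initial pieces of segments and of rays are handled alike.\<close>

definition isometric_path :: "(real \<Rightarrow> 'a::metric_space) \<Rightarrow> real \<Rightarrow> bool" where
  "isometric_path g L \<longleftrightarrow> (\<forall>s\<in>{0..L}. \<forall>t\<in>{0..L}. dist (g s) (g t) = \<bar>s - t\<bar>)"

lemma isometric_path_dist:
  "isometric_path g L \<Longrightarrow> 0 \<le> s \<Longrightarrow> s \<le> L \<Longrightarrow> 0 \<le> t \<Longrightarrow> t \<le> L \<Longrightarrow> dist (g s) (g t) = \<bar>s - t\<bar>"
  by (auto simp: isometric_path_def)

lemma isometric_path_cong:
  assumes "isometric_path g L" "\<And>t. 0 \<le> t \<Longrightarrow> t \<le> L \<Longrightarrow> h t = g t"
  shows "isometric_path h L"
  using assms by (simp add: isometric_path_def)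

lemma isometric_path_subset: "isometric_path g L \<Longrightarrow> K \<le> L \<Longrightarrow> isometric_path g K"
  by (auto simp: isometric_path_def)

lemma isometric_path_segment:
  "isometric_path g L \<Longrightarrow> 0 \<le> L \<Longrightarrow> geodesic_segment g (g 0) (g L)"
  by (auto simp: isometric_path_def geodesic_segment_def)

lemma geodesic_segment_isometric: "geodesic_segment g x y \<Longrightarrow> isometric_path g (dist x y)"
  by (auto simp: isometric_path_def geodesic_segment_def)

lemma geodesic_ray_isometric: "geodesic_ray g \<Longrightarrow> isometric_path g L"
  by (auto simp: isometric_path_def geodesic_ray_def)

lemma isometric_path_unit_speed:
  assumes "isometric_path g L"
  shows "unit_speed g L"
  unfolding unit_speed_def
proof (intro allI impI, elim conjE)
  fix s t :: real
  assume st: "0 \<le> s" "s \<le> t" "t \<le> L"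
  have "ennreal (\<Sum>i<length ts - 1. dist (g (ts ! i)) (g (ts ! Suc i))) \<le> ennreal (t - s)"
    if ts: "sorted ts" "set ts \<subseteq> {s..t}" for ts
  proof -
    have "dist (g (ts ! i)) (g (ts ! Suc i)) = ts ! Suc i - ts ! i" if "i < length ts - 1" for i
    proof -
      have "ts ! i \<in> {s..t}" "ts ! Suc i \<in> {s..t}"
        using that by (auto intro!: subsetD[OF ts(2)] nth_mem simp del: atLeastAtMost_iff)
      moreover have "ts ! i \<le> ts ! Suc i"
        using ts(1) that by (auto intro: sorted_nth_mono)
      ultimately show ?thesis
        using st by (subst isometric_path_dist[OF assms]) auto
    qed
    then show ?thesis
      using telescope_sorted_le[OF ts st(2)] by (simp add: ennreal_leI)
  qed
  then have "curve_length g s t \<le> ennreal (t - s)"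
    unfolding curve_length_def by (auto intro!: SUP_least)
  moreover have "dist (g s) (g t) = t - s"
    using st by (subst isometric_path_dist[OF assms]) auto
  ultimately show "curve_length g s t = ennreal (t - s)"
    using dist_le_curve_length[OF st(2), of g] by (simp add: order_antisym)
qed

lemma isometric_path_D_short:
  assumes "isometric_path g L" "0 \<le> L" "0 \<le> D L"
  shows "D_short D g L"
proof -
  have "continuous_on {0..L} g"
    using assms(1) by (intro lipschitz_on_continuous_on[where L=1] lipschitz_onI)
      (auto simp: isometric_path_def dist_real_def)
  moreover have "curve_length g 0 L = ennreal L"
    using isometric_path_unit_speed[OF assms(1)] assms(2) by (auto simp: unit_speed_def)
  moreover have "dist (g 0) (g L) = L"
    using assms by (subst isometric_path_dist[OF assms(1)]) auto
  ultimately show ?thesis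
    using assms by (auto simp: D_short_def short_segment_def intro!: ennreal_leI)
qed

lemma unit_speed_dist:
  assumes "unit_speed g L" "0 \<le> s" "s \<le> t" "t \<le> L"
  shows "dist (g s) (g t) \<le> t - s"
proof -
  have "ennreal (dist (g s) (g t)) \<le> ennreal (t - s)"
    using dist_le_curve_length[of s t g] assms by (auto simp: unit_speed_def)
  then show ?thesis using assms by simp
qed

lemma D_short_length:
  assumes "unit_speed g L" "D_short D g L" "0 \<le> D (dist (g 0) (g L))"
  shows "0 \<le> L" "L \<le> dist (g 0) (g L) + D (dist (g 0) (g L))"
proof -
  show "0 \<le> L" using assms(2) by (simp add: D_short_def short_segment_def)
  then have "ennreal L \<le> ennreal (dist (g 0) (g L) + D (dist (g 0) (g L)))"
    using assms(1,2) by (auto simp: D_short_def short_segment_def unit_speed_def)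
  then show "L \<le> dist (g 0) (g L) + D (dist (g 0) (g L))"
    using assms(3) by (simp add: ennreal_le_iff del: ennreal_plus)
qed

section \<open>Geodesics in CAT(0) spaces\<close>

lemma exists_plane_triangle:
  fixes a b c :: real
  assumes "0 \<le> a" "0 \<le> b" "0 \<le> c" "a \<le> b + c" "b \<le> a + c" "c \<le> a + b"
  shows "\<exists>p q r :: real^2. dist p q = a \<and> dist p r = b \<and> dist q r = c"
proof (cases "a = 0")
  case True
  then have "b = c" using assms by auto
  then show ?thesis
    using True assms
    by (intro exI[of _ 0] exI[of _ "b *\<^sub>R axis 1 1"])  (auto simp: dist_norm)
next
  case False
  \<comment> \<open>By the law of cosines, \<open>u\<close> is the first coordinate of the third
    vertex when the other two are at the origin and at \<open>(a, 0)\<close>. The triangle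
    inequalities give |u| \<le> b, so the second coordinate \<open>v\<close> exists.\<close>
  define u where "u = (a\<^sup>2 + b\<^sup>2 - c\<^sup>2) / (2 * a)"
  have au: "2 * a * u = a\<^sup>2 + b\<^sup>2 - c\<^sup>2" using False by (simp add: u_def)
  have "2 * a * u \<le> 2 * a * b"
  proof -
    have "(a - b)\<^sup>2 \<le> c\<^sup>2" using assms by (intro abs_le_square_iff[THEN iffD1]) auto
    then show ?thesis unfolding au by (simp add: power2_eq_square algebra_simps)
  qed
  moreover have "2 * a * (- b) \<le> 2 * a * u"
  proof -
    have "c\<^sup>2 \<le> (a + b)\<^sup>2" using assms by (intro power_mono) auto
    then show ?thesis unfolding au by (simp add: power2_eq_square algebra_simps)
  qed
  ultimately have "a * u \<le> a * b" "a * (- b) \<le> a * u" by simp_all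
  then have "\<bar>u\<bar> \<le> b" using False assms(1) by (auto simp only: abs_le_iff mult_le_cancel_left)
  then have ub: "u\<^sup>2 \<le> b\<^sup>2" using abs_le_square_iff[of u b] assms by auto
  define v where "v = sqrt (b\<^sup>2 - u\<^sup>2)"
  have v: "v\<^sup>2 = b\<^sup>2 - u\<^sup>2" using ub by (simp add: v_def)
  have d: "dist (vector [p, q] :: real^2) (vector [r, s]) = sqrt ((p - r)\<^sup>2 + (q - s)\<^sup>2)"
    for p q r s :: real
    by (simp add: dist_vec_def L2_set_def sum_2 vector_2 dist_real_def)
  have "dist (vector [0, 0] :: real^2) (vector [a, 0]) = a"
    using assms by (simp add: d)
  moreover have "dist (vector [0, 0] :: real^2) (vector [u, v]) = b"
    using assms v by (simp add: d)
  moreover have "(a - u)\<^sup>2 + v\<^sup>2 = c\<^sup>2"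
    using au v by (simp add: power2_diff algebra_simps)
  then have "dist (vector [a, 0] :: real^2) (vector [u, v]) = c"
    using assms v by (simp add: d)
  ultimately show ?thesis by blast
qed

lemma stewart_inner:
  fixes p q y :: "'a::real_inner"
  shows "(dist y ((1 - l) *\<^sub>R p + l *\<^sub>R q))\<^sup>2 =
     (1 - l) * (dist y p)\<^sup>2 + l * (dist y q)\<^sup>2 - l * (1 - l) * (dist p q)\<^sup>2"
  unfolding dist_norm power2_norm_eq_inner
  by (simp add: inner_diff_left inner_diff_right inner_add_left inner_add_right inner_commute)
    (simp add: algebra_simps)

text \<open>In the plane this is an equality. The CAT(0) condition transfers it when the second
  point of the comparison is the vertex \<open>y\<close>.\<close>

lemma stewart:
  fixes p q y :: "'a::metric_space"
  assumes cat0: "CAT0 TYPE('a)" and g: "geodesic_segment g p q" and l: "0 \<le> l" "l \<le> 1"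
  shows "(dist y (g (l * dist p q)))\<^sup>2 \<le>
     (1 - l) * (dist y p)\<^sup>2 + l * (dist y q)\<^sup>2 - l * (1 - l) * (dist p q)\<^sup>2"
proof -
  obtain yb pb qb :: "real^2" where
    tri: "dist yb pb = dist y p" "dist yb qb = dist y q" "dist pb qb = dist p q"
    using exists_plane_triangle[of "dist y p" "dist y q" "dist p q"]
      dist_triangle[of y p q] dist_triangle[of y q p] dist_triangle[of p q y]
    by (auto simp: dist_commute algebra_simps)
  obtain h k where h: "geodesic_segment h q y" and k: "geodesic_segment k y p"
    using cat0 unfolding CAT0_def geodesic_space_def by metis
  define x where "x = (\<lambda>i::3. if i = 0 then y else if i = 1 then p else q)"
  define xb where "xb = (\<lambda>i::3. if i = 0 then yb else if i = 1 then pb else qb)"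
  define G where "G = (\<lambda>i::3. if i = 0 then g else if i = 1 then h else k)"
  have three: "(\<forall>i::3. P i) \<longleftrightarrow> P 0 \<and> P 1 \<and> P 2" for P
  proof -
    have "(3::3) = 0" by simp
    then show ?thesis using forall_3[of P] by (auto simp only:)
  qed
  have segs: "\<forall>i. geodesic_segment (G i) (x (i + 1)) (x (i + 2))"
    using g h k unfolding three by (simp add: G_def x_def)
  have comp: "comparison_vertices x xb"
    unfolding comparison_vertices_def three using tri by (simp add: x_def xb_def dist_commute)
  define ub where "ub = (1 - l) *\<^sub>R pb + l *\<^sub>R qb"
  have ub: "ub \<in> plane_side xb 0"
    using l by (auto simp: plane_side_def xb_def ub_def closed_segment_def)
  have "dist pb ub = l * dist p q"
  proof -
    have "pb - ub = l *\<^sub>R (pb - qb)" by (simp add: ub_def algebra_simps)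
    then show ?thesis using l tri by (simp add: dist_norm)
  qed
  also have "\<dots> = dist p (g (l * dist p q))"
    using g l mult_right_mono[of l 1 "dist p q"]
      isometric_path_dist[OF geodesic_segment_isometric[OF g], of 0 "l * dist p q"]
    by (auto simp: geodesic_segment_def)
  finally have ub_dist: "dist (xb (0 + 1)) ub = dist (x (0 + 1)) (G 0 (l * dist p q))"
    by (simp add: xb_def x_def G_def)
  \<comment> \<open>The vertex \<open>y\<close> is regarded as the far end of side 1, which runs
    from \<open>q\<close> to \<open>y\<close>.\<close>
  have "dist (G 0 (l * dist p q)) (G 1 (dist q y)) \<le> dist ub (xb 0)"
    using cat0[unfolded CAT0_def, THEN conjunct2, rule_format,
        of G x xb "l * dist p q" 0 "dist q y" 1 ub "xb 0"] segs comp ub ub_dist l h tri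
      mult_right_mono[of l 1 "dist p q"]
    by (simp add: x_def xb_def G_def plane_side_def geodesic_segment_def dist_commute)
  then have "dist y (g (l * dist p q)) \<le> dist yb ub"
    using h by (simp add: G_def xb_def geodesic_segment_def dist_commute)
  then have "(dist y (g (l * dist p q)))\<^sup>2 \<le> (dist yb ub)\<^sup>2"
    by (simp add: power_mono)
  then show ?thesis
    unfolding ub_def stewart_inner tri .
qed

context
  assumes cat0: "CAT0 TYPE('a::metric_space)"
begin

section \<open>Contraction towards a common starting point\<close>

text \<open>Stewart's inequality is used twice: for \<open>?u\<close> against the side from
  \<open>p\<close> to \<open>y\<close>, and for \<open>y\<close> against the side from
  \<open>p\<close> to \<open>x\<close>. Inserting the second, multiplied by \<open>l\<close>, into
  the first cancels everything except the square of \<open>l * dist x y\<close>.\<close>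

lemma geodesic_contraction:
  fixes p x y :: 'a
  assumes g: "geodesic_segment g p x" and h: "geodesic_segment h p y" and l: "0 \<le> l" "l \<le> 1"
  shows "dist (g (l * dist p x)) (h (l * dist p y)) \<le> l * dist x y"
proof -
  let ?u = "g (l * dist p x)"
  have "(dist ?u (h (l * dist p y)))\<^sup>2 \<le>
      (1 - l) * (dist ?u p)\<^sup>2 + l * (dist ?u y)\<^sup>2 - l * (1 - l) * (dist p y)\<^sup>2"
    by (rule stewart[OF cat0 h l])
  moreover have "(dist y ?u)\<^sup>2 \<le>
      (1 - l) * (dist y p)\<^sup>2 + l * (dist y x)\<^sup>2 - l * (1 - l) * (dist p x)\<^sup>2"
    by (rule stewart[OF cat0 g l])
  then have "l * (dist y ?u)\<^sup>2 \<le>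
      l * ((1 - l) * (dist y p)\<^sup>2 + l * (dist y x)\<^sup>2 - l * (1 - l) * (dist p x)\<^sup>2)"
    using l by (simp add: mult_left_mono)
  moreover have "dist p ?u = l * dist p x"
    using g l mult_right_mono[of l 1 "dist p x"]
      isometric_path_dist[OF geodesic_segment_isometric[OF g], of 0 "l * dist p x"]
    by (simp add: geodesic_segment_def)
  ultimately have "(dist ?u (h (l * dist p y)))\<^sup>2 \<le> (l * dist x y)\<^sup>2"
    by (simp add: dist_commute power2_eq_square algebra_simps)
  then show ?thesis
    by (rule power2_le_imp_le) (use l in simp)
qed

lemma isometric_path_contraction:
  fixes g h :: "real \<Rightarrow> 'a"
  assumes "isometric_path g T" "isometric_path h T" "g 0 = h 0" "0 \<le> t" "t \<le> T" "0 < T"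
  shows "dist (g t) (h t) \<le> t / T * dist (g T) (h T)"
proof -
  have "dist (g 0) (g T) = T" "dist (g 0) (h T) = T"
    using isometric_path_dist[OF assms(1), of 0 T] isometric_path_dist[OF assms(2), of 0 T] assms
    by simp_all
  then show ?thesis
    using geodesic_contraction[OF isometric_path_segment[OF assms(1)], of h "h T" "t / T"]
      isometric_path_segment[OF assms(2)] assms by simp
qed

lemma geodesic_unique:
  fixes x y :: 'a
  assumes "geodesic_segment g x y" "geodesic_segment h x y" "0 \<le> t" "t \<le> dist x y"
  shows "g t = h t"
proof (cases "x = y")
  case True
  then show ?thesis using assms by (auto simp: geodesic_segment_def)
next
  case False
  then show ?thesis
    using geodesic_contraction[OF assms(1,2), of "t / dist x y"] assms by simp
qed

end

section \<open>Geodesics that rest at their endpoint, and paths near them\<close>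

text \<open>The clamp makes the path rest at \<open>y\<close>, just as a finite length bouquet does,
  so the two can be compared at every nonnegative parameter.\<close>

definition geod :: "'a::metric_space \<Rightarrow> 'a \<Rightarrow> real \<Rightarrow> 'a" where
  "geod x y t = (SOME g. geodesic_segment g x y) (min t (dist x y))"

lemma geod_after: "dist x y \<le> t \<Longrightarrow> geod x y t = geod x y (dist x y)"
  by (simp add: geod_def min_def)

context
  assumes cat0: "CAT0 TYPE('a::metric_space)"
begin

lemma geod_segment:
  fixes x y :: 'a
  shows "geodesic_segment (geod x y) x y"
proof -
  have "\<exists>g. geodesic_segment g x y"
    using cat0 unfolding CAT0_def geodesic_space_def by blast
  then have "geodesic_segment (SOME g. geodesic_segment g x y) x y"
    by (rule someI_ex)
  then show ?thesis by (simp add: geodesic_segment_def geod_def)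
qed

lemma geod_0 [simp]:
  fixes x y :: 'a
  shows "geod x y 0 = x"
  using geod_segment[of x y] by (simp add: geodesic_segment_def)

lemma geod_end [simp]:
  fixes x y :: 'a
  shows "geod x y (dist x y) = y"
  using geod_segment[of x y] by (simp add: geodesic_segment_def)

lemma geod_beyond:
  fixes x y :: 'a
  shows "dist x y \<le> t \<Longrightarrow> geod x y t = y"
  by (simp add: geod_after)

lemma geod_isometric:
  fixes x y :: 'a
  shows "L \<le> dist x y \<Longrightarrow> isometric_path (geod x y) L"
  using geod_segment geodesic_segment_isometric isometric_path_subset by blast

lemma geod_dist_start:
  fixes x y :: 'a
  shows "0 \<le> t \<Longrightarrow> dist x (geod x y t) = min t (dist x y)"
  using isometric_path_dist[OF geod_isometric[of "dist x y" x y], of 0 t]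
  by (cases "t \<le> dist x y") (auto simp: geod_beyond)

lemma geod_lipschitz:
  fixes x y :: 'a
  assumes "0 \<le> s" "0 \<le> t"
  shows "dist (geod x y s) (geod x y t) \<le> \<bar>s - t\<bar>"
proof -
  have clamp: "geod x y r = geod x y (min r (dist x y))" for r
    by (simp add: geod_def)
  have "dist (geod x y (min s (dist x y))) (geod x y (min t (dist x y))) =
      \<bar>min s (dist x y) - min t (dist x y)\<bar>"
    by (rule isometric_path_dist[OF geod_isometric[OF order_refl]]) (use assms in auto)
  then have "dist (geod x y s) (geod x y t) = \<bar>min s (dist x y) - min t (dist x y)\<bar>"
    using clamp by metis
  then show ?thesis by linarith
qed

text \<open>Contraction by \<open>l = t / dist p x\<close> gives \<open>l * K\<close> between equal
  fractions of the geodesic to \<open>x\<close> and of the piece ending at parameter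
  \<open>s\<close>. Passing from parameter \<open>l * s\<close> to \<open>t = l * dist p x\<close>
  costs another \<open>l * K\<close>, because \<open>s\<close> and \<open>dist p x\<close> differ by
  at most \<open>K\<close>. The decay in \<open>dist p x\<close> is what makes geodesics to distant
  points converge.\<close>

lemma geod_near_start_scaled:
  fixes p x y :: 'a
  assumes "0 \<le> s" "s \<le> dist p y" "dist x (geod p y s) \<le> K" "0 \<le> t" "t \<le> dist p x" "0 < dist p x"
  shows "dist (geod p x t) (geod p y t) \<le> 2 * K * t / dist p x"
proof -
  define l where "l = t / dist p x"
  have l: "0 \<le> l" "l \<le> 1" "l * dist p x = t" using assms by (auto simp: l_def)
  have seg: "geodesic_segment (geod p y) p (geod p y s)"
    using isometric_path_segment[OF geod_isometric[OF assms(2)]] assms by simp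
  have s: "dist p (geod p y s) = s"
    using assms by (simp add: geod_dist_start)
  have "dist (geod p x t) (geod p y (l * s)) \<le> l * dist x (geod p y s)"
    using geodesic_contraction[OF cat0 geod_segment seg l(1,2), of x] l(3) s by simp
  also have "\<dots> \<le> l * K" using l assms by (simp add: mult_left_mono)
  finally have 1: "dist (geod p x t) (geod p y (l * s)) \<le> l * K" .
  have "\<bar>s - dist p x\<bar> \<le> K"
    using s assms(3) dist_triangle[of p x "geod p y s"] dist_triangle[of p "geod p y s" x]
    by (simp add: dist_commute)
  then have "l * \<bar>s - dist p x\<bar> \<le> l * K" using l by (simp add: mult_left_mono)
  moreover have "\<bar>l * s - t\<bar> = l * \<bar>s - dist p x\<bar>"
    using l by (simp flip: l(3) right_diff_distrib add: abs_mult)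
  moreover have "dist (geod p y (l * s)) (geod p y t) \<le> \<bar>l * s - t\<bar>"
    using assms l by (intro geod_lipschitz) auto
  ultimately have "dist (geod p x t) (geod p y t) \<le> l * K + l * K"
    using 1 dist_triangle[of "geod p x t" "geod p y t" "geod p y (l * s)"] by linarith
  then show ?thesis by (simp add: l_def mult_ac)
qed

text \<open>
  By Stewart's inequality the squared distance is at most \<open>(L\<^sup>2 - d\<^sup>2) / 4\<close> for a path of
  length \<open>L\<close> between points at distance \<open>d\<close>; this is where the shortness \<open>1 / d\<close> is needed.
\<close>

lemma short_path_near_geod:
  fixes g :: "real \<Rightarrow> 'a"
  assumes g: "unit_speed g L" "L \<le> dist (g 0) (g L) + h"
    and h: "0 \<le> h" "h \<le> 1 / max 1 (dist (g 0) (g L))"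
    and s: "0 \<le> s" "s \<le> L"
  shows "dist (g s) (geod (g 0) (g L) (s / L * dist (g 0) (g L))) \<le> 1"
    and "dist (g s) (geod (g 0) (g L) s) \<le> 2"
proof -
  define d where "d = dist (g 0) (g L)"
  define l where "l = s / L"
  have l: "0 \<le> l" "l \<le> 1" "l * L = s" using s by (auto simp: l_def divide_simps)
  have d: "0 \<le> d" "d \<le> L" using unit_speed_dist[OF g(1), of 0 L] s by (auto simp: d_def)
  have h1: "h \<le> 1" using h(2) by (rule order_trans) simp
  have "h * max 1 d \<le> 1" using h(2) by (simp add: d_def[symmetric] field_simps)
  then have hd: "h * d \<le> 1" using h(1) mult_left_mono[of d "max 1 d" h] by linarith
  have "L\<^sup>2 \<le> (d + h)\<^sup>2" using g(2) d s by (auto simp: d_def intro!: power_mono)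
  also have "\<dots> = d\<^sup>2 + 2 * (h * d) + h\<^sup>2" by (simp add: power2_sum mult_ac)
  \<comment> \<open>The cross term is at most 2 and the square of \<open>h\<close> at most
    1.\<close>
  also have "\<dots> \<le> d\<^sup>2 + 3"
    using hd power_le_one[OF h(1) h1, of 2] by simp
  finally have Ld: "L\<^sup>2 - d\<^sup>2 \<le> 3" by simp
  have ll: "l * (1 - l) \<le> 1 / 4"
    using zero_le_power2[of "l - 1 / 2"] by (simp add: power2_eq_square algebra_simps)
  let ?z = "geod (g 0) (g L) (l * dist (g 0) (g L))"
  have "(dist (g s) ?z)\<^sup>2 \<le>
      (1 - l) * (dist (g s) (g 0))\<^sup>2 + l * (dist (g s) (g L))\<^sup>2 - l * (1 - l) * d\<^sup>2"
    unfolding d_def by (rule stewart[OF cat0 geod_segment l(1,2)])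
  also have "\<dots> \<le> (1 - l) * s\<^sup>2 + l * (L - s)\<^sup>2 - l * (1 - l) * d\<^sup>2"
    using unit_speed_dist[OF g(1), of 0 s] unit_speed_dist[OF g(1), of s L] s l
    by (intro diff_right_mono add_mono mult_left_mono power_mono) (auto simp: dist_commute)
  also have "\<dots> = l * (1 - l) * (L\<^sup>2 - d\<^sup>2)"
    by (simp flip: l(3) add: power2_eq_square algebra_simps)
  also have "\<dots> \<le> 1 / 4 * 3"
    using Ld ll l d by (intro mult_mono) (auto intro!: power_mono)
  finally have "(dist (g s) ?z)\<^sup>2 \<le> 1\<^sup>2" by simp
  then have 1: "dist (g s) ?z \<le> 1" by (rule power2_le_imp_le) simp
  then show "dist (g s) (geod (g 0) (g L) (s / L * dist (g 0) (g L))) \<le> 1" by (simp add: l_def)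
  \<comment> \<open>The first bound compares equal fractions of path and geodesic. Passing to equal
    parameters moves along the geodesic by at most the excess length \<open>L - d\<close>.\<close>
  have "\<bar>l * d - s\<bar> = l * (L - d)"
    using l d by (simp flip: l(3) right_diff_distrib add: abs_mult)
  also have "\<dots> \<le> 1 * (L - d)" using l d by (intro mult_right_mono) auto
  also have "\<dots> \<le> 1" using g(2) h1 by (simp add: d_def)
  finally have "\<bar>l * d - s\<bar> \<le> 1" .
  moreover have "dist ?z (geod (g 0) (g L) s) \<le> \<bar>l * d - s\<bar>"
    unfolding d_def using l s by (intro geod_lipschitz) auto
  ultimately show "dist (g s) (geod (g 0) (g L) s) \<le> 2"
    using 1 dist_triangle[of "g s" "geod (g 0) (g L) s" ?z] by linarith
qed

text \<open>The bound is needed beyond the ends of the geodesics as well. There the path to the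
  nearer point has stopped, and what remains of the other is no longer than the difference of the
  two distances from \<open>p\<close>.\<close>

lemma geod_dist_le:
  fixes p x y :: 'a
  assumes "0 \<le> t"
  shows "dist (geod p x t) (geod p y t) \<le> 2 * dist x y"
proof -
  have *: "dist (geod p x t) (geod p y t) \<le> 2 * dist x y" if "dist p x \<le> dist p y" for x y :: 'a
  proof (cases "t \<le> dist p x \<and> 0 < dist p x")
    case True
    then have "2 * dist x y * t / dist p x \<le> 2 * dist x y"
      using assms mult_left_mono[of "t / dist p x" 1 "2 * dist x y"] by simp
    then show ?thesis
      using geod_near_start_scaled[of "dist p y" p y x "dist x y" t] True assms by simp
  next
    case False
    then have "geod p x t = x" using assms by (auto intro!: geod_beyond)
    moreover have "dist y (geod p y t) \<le> dist x y"
    proof (cases "t \<le> dist p y")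
      case True
      then have "dist y (geod p y t) \<le> dist p y - t"
        using geod_lipschitz[of "dist p y" t p y] assms by simp
      also have "\<dots> \<le> dist p y - dist p x" using False assms by auto
      also have "\<dots> \<le> dist x y" using dist_triangle[of p y x] by simp
      finally show ?thesis .
    qed (simp add: geod_beyond)
    ultimately show ?thesis
      using dist_triangle[of x "geod p y t" y] by simp
  qed
  show ?thesis
    using *[of x y] *[of y x] by (cases "dist p x \<le> dist p y") (auto simp: dist_commute)
qed

section \<open>Limits of geodesics and change of the starting point\<close>

text \<open>The points run off to infinity, so \<open>near\<close> asks that each lie close to the
  geodesics to all later ones. By \<open>geod_near_start_scaled\<close> the geodesics to
  \<open>x m\<close> and \<open>x n\<close> then differ at a fixed \<open>t\<close> by at most
  \<open>2 * K * t / dist p (x m)\<close>. This tends to 0, so they form a Cauchy sequence at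
  \<open>t\<close>; for \<open>t\<close> up to \<open>dist p (x m)\<close> it is at most
  \<open>2 * K\<close>, a bound that survives in the limit.\<close>

lemma exists_limit_ray:
  fixes p :: 'a and x :: "nat \<Rightarrow> 'a"
  assumes complete: "complete (UNIV :: 'a set)"
    and lim: "filterlim (\<lambda>n. dist p (x n)) at_top sequentially"
    and near: "\<And>m n. m \<le> n \<Longrightarrow> \<exists>s. 0 \<le> s \<and> s \<le> dist p (x n) \<and> dist (x m) (geod p (x n) s) \<le> K"
  shows "\<exists>r. geodesic_ray r \<and> r 0 = p \<and>
    (\<forall>m t. 0 \<le> t \<and> t \<le> dist p (x m) \<longrightarrow> dist (r t) (geod p (x m) t) \<le> 2 * K)"
proof -
  let ?p = "\<lambda>n t. geod p (x n) t"
  have K: "0 \<le> K"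
    using near[of 0 0] by (meson order_trans order_refl zero_le_dist)
  have close: "dist (?p m t) (?p n t) \<le> 2 * K * t / dist p (x m)"
    if "m \<le> n" "0 \<le> t" "t \<le> dist p (x m)" "0 < dist p (x m)" for m n t
    using near[OF that(1)] geod_near_start_scaled that(2-) by blast
  have "Cauchy (\<lambda>n. ?p n t)" if t: "0 \<le> t" for t
  proof (rule metric_CauchyI)
    fix e :: real assume e: "0 < e"
    \<comment> \<open>The second condition pushes the bound of \<open>close\<close> from index
      \<open>N\<close> below \<open>e / 2\<close>.\<close>
    have "eventually (\<lambda>n. t < dist p (x n) \<and> 4 * K * t / e < dist p (x n)) sequentially"
      using lim by (intro eventually_conj) (simp_all add: filterlim_at_top_dense)
    then obtain N where N: "t < dist p (x N)" "4 * K * t / e < dist p (x N)"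
      unfolding eventually_sequentially by auto
    have half: "dist (?p N t) (?p n t) < e / 2" if "N \<le> n" for n
    proof -
      have "4 * K * t < e * dist p (x N)" using N(2) e by (simp add: pos_divide_less_eq mult_ac)
      then have small: "2 * K * t / dist p (x N) < e / 2"
        using N(1) t by (subst pos_divide_less_eq) auto
      show ?thesis
        by (rule le_less_trans[OF close[OF that t] small]) (use N(1) t in auto)
    qed
    have "dist (?p m t) (?p n t) < e" if "m \<ge> N" "n \<ge> N" for m n
      using half[OF that(1)] half[OF that(2)] dist_triangle3[of "?p m t" "?p n t" "?p N t"]
      by linarith
    then show "\<exists>M. \<forall>m\<ge>M. \<forall>n\<ge>M. dist (?p m t) (?p n t) < e" by blast
  qed
  then have "\<exists>l. (\<lambda>n. ?p n t) \<longlonglongrightarrow> l" if "0 \<le> t" for t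
    using complete that unfolding complete_def by simp
  then obtain r where r: "(\<lambda>n. ?p n t) \<longlonglongrightarrow> r t" if "0 \<le> t" for t by metis
  have "dist (r s) (r t) = \<bar>s - t\<bar>" if st: "0 \<le> s" "0 \<le> t" for s t
  proof -
    have "(\<lambda>n. dist (?p n s) (?p n t)) \<longlonglongrightarrow> dist (r s) (r t)"
      by (intro tendsto_dist r st)
    moreover have "eventually (\<lambda>n. s \<le> dist p (x n) \<and> t \<le> dist p (x n)) sequentially"
      using lim by (intro eventually_conj) (simp_all add: filterlim_at_top)
    then have "eventually (\<lambda>n. dist (?p n s) (?p n t) = \<bar>s - t\<bar>) sequentially"
      by eventually_elim (rule isometric_path_dist[OF geod_isometric[OF order_refl]], use st in auto)
    then have "(\<lambda>n. dist (?p n s) (?p n t)) \<longlonglongrightarrow> \<bar>s - t\<bar>"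
      by (rule tendsto_eventually)
    ultimately show ?thesis by (rule LIMSEQ_unique)
  qed
  then have "geodesic_ray r" by (simp add: geodesic_ray_def)
  moreover have "r 0 = p"
    using r[of 0] by (simp add: LIMSEQ_const_iff)
  moreover have "dist (r t) (?p m t) \<le> 2 * K" if t: "0 \<le> t" "t \<le> dist p (x m)" for m t
  proof (cases "0 < dist p (x m)")
    case True
    have "2 * K * t / dist p (x m) \<le> 2 * K"
      using t True K mult_left_mono[of "t / dist p (x m)" 1 "2 * K"] by simp
    then have "dist (?p n t) (?p m t) \<le> 2 * K" if "m \<le> n" for n
      using close[OF that t True] by (simp add: dist_commute)
    moreover have "(\<lambda>n. dist (?p n t) (?p m t)) \<longlonglongrightarrow> dist (r t) (?p m t)"
      by (intro tendsto_dist r t tendsto_const)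
    ultimately show ?thesis by (intro LIMSEQ_le_const2) auto
  next
    case False
    then show ?thesis using t K \<open>r 0 = p\<close> by (cases "t = 0") auto
  qed
  ultimately show ?thesis by blast
qed

text \<open>The new ray is the limit of the geodesics from \<open>p\<close> to the points
  \<open>g n\<close>. The factor 5 is 2 + 1 + 2: the limit against one such geodesic,
  \<open>g t\<close> against a nearby point of that geodesic, and the shift of this point to
  parameter \<open>t\<close>.\<close>

lemma asymptotic_ray_from:
  fixes p :: 'a
  assumes complete: "complete (UNIV :: 'a set)" and g: "geodesic_ray g"
  shows "\<exists>r. geodesic_ray r \<and> r 0 = p \<and> (\<forall>t\<ge>0. dist (r t) (g t) \<le> 5 * dist p (g 0))"
proof -
  define K where "K = dist p (g 0)"
  have g_dist: "dist (g s) (g t) = \<bar>s - t\<bar>" if "0 \<le> s" "0 \<le> t" for s t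
    using g that by (simp add: geodesic_ray_def)
  have len: "\<bar>dist p (g t) - t\<bar> \<le> K" if "0 \<le> t" for t
    using g_dist[of 0 t] that dist_triangle[of p "g t" "g 0"] dist_triangle[of "g 0" "g t" p]
    by (simp add: K_def dist_commute)
  have lim: "filterlim (\<lambda>n. dist p (g (real n))) at_top sequentially"
  proof (rule filterlim_at_top_mono)
    show "filterlim (\<lambda>n. - K + real n) at_top sequentially"
      by (intro filterlim_tendsto_add_at_top[OF tendsto_const] filterlim_real_sequentially)
    have "- K + real n \<le> dist p (g (real n))" for n
      using len[of "real n"] by (simp add: abs_le_iff)
    then show "eventually (\<lambda>n. - K + real n \<le> dist p (g (real n))) sequentially"
      by simp
  qed
  have near: "\<exists>s. 0 \<le> s \<and> s \<le> dist p (g n) \<and> dist (g m) (geod p (g n) s) \<le> K"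
    if mn: "0 \<le> m" "m \<le> n" "0 < n" for m n
  proof -
    \<comment> \<open>The triangle with vertices \<open>p\<close>, \<open>g 0\<close>,
      \<open>g n\<close> is contracted towards \<open>g n\<close>, so both geodesics are run
      backwards. At fraction \<open>l\<close> the one ending at \<open>g 0\<close> passes through
      \<open>g m\<close>.\<close>
    define l where "l = (n - m) / n"
    have l: "0 \<le> l" "l \<le> 1" "l * n = n - m" using mn by (auto simp: l_def)
    define h where "h = (\<lambda>t. geod p (g n) (dist p (g n) - t))"
    have "geodesic_segment h (g n) p"
      unfolding geodesic_segment_def h_def
      using isometric_path_dist[OF geod_isometric[OF order_refl], of _ p "g n"]
      by (auto simp: dist_commute)
    moreover have "geodesic_segment (\<lambda>t. g (n - t)) (g n) (g 0)"
      unfolding geodesic_segment_def using mn g_dist[of n 0] by (auto simp: g_dist)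
    ultimately have "dist (h (l * dist (g n) p)) (g (n - l * dist (g n) (g 0))) \<le> l * dist p (g 0)"
      using geodesic_contraction[OF cat0 _ _ l(1,2)] by blast
    also have "\<dots> \<le> K" using l by (simp add: K_def mult_left_le_one_le)
    finally have "dist (g m) (geod p (g n) (dist p (g n) - l * dist p (g n))) \<le> K"
      using g_dist[of n 0] mn l by (simp add: h_def dist_commute)
    moreover have "l * dist p (g n) \<le> dist p (g n)"
      using l by (simp add: mult_left_le_one_le)
    ultimately show ?thesis
      using l by (intro exI[of _ "dist p (g n) - l * dist p (g n)"]) simp
  qed
  have "\<exists>s. 0 \<le> s \<and> s \<le> dist p (g (real n)) \<and> dist (g (real m)) (geod p (g (real n)) s) \<le> K"
    if "m \<le> n" for m n
  proof (cases "n = 0")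
    case True
    then show ?thesis using that by (intro exI[of _ 0]) (auto simp: K_def dist_commute)
  next
    case False
    then show ?thesis using near[of "real m" "real n"] that by simp
  qed
  then obtain r where r: "geodesic_ray r" "r 0 = p"
    "\<And>m t. 0 \<le> t \<Longrightarrow> t \<le> dist p (g (real m)) \<Longrightarrow> dist (r t) (geod p (g (real m)) t) \<le> 2 * K"
    using exists_limit_ray[OF complete lim, of K] by blast
  have "dist (r t) (g t) \<le> 5 * K" if t: "0 \<le> t" for t
  proof -
    \<comment> \<open>Since \<open>dist p (g m)\<close> is at least \<open>m - K\<close>, the
      geodesic to \<open>g m\<close> reaches parameter \<open>t\<close>. The summand 1 keeps
      \<open>m\<close> positive, as \<open>near\<close> requires.\<close>
    obtain m :: nat where m: "t + K + 1 \<le> real m" using real_arch_simple by blast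
    have K: "0 \<le> K" by (simp add: K_def)
    have tm: "t \<le> dist p (g (real m))" using len[of "real m"] m by (simp add: abs_le_iff)
    obtain s where s: "0 \<le> s" "s \<le> dist p (g m)" "dist (g t) (geod p (g m) s) \<le> K"
      using near[of t "real m"] t m K by auto
    have "\<bar>s - t\<bar> \<le> 2 * K"
      using len[OF t] s geod_dist_start[of s p "g m"]
        dist_triangle[of p "geod p (g m) s" "g t"] dist_triangle[of p "g t" "geod p (g m) s"]
      by (simp add: dist_commute abs_le_iff)
    then have "dist (geod p (g m) s) (geod p (g m) t) \<le> 2 * K"
      using geod_lipschitz[OF s(1) t] by (rule order_trans[rotated])
    then have "dist (r t) (g t) \<le> 2 * K + K + 2 * K"
      using r(3)[OF t tm] s(3)
        dist_triangle[of "r t" "g t" "geod p (g m) t"]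
        dist_triangle[of "geod p (g m) t" "g t" "geod p (g m) s"]
      by (simp add: dist_commute)
    then show ?thesis by simp
  qed
  then show ?thesis using r unfolding K_def by blast
qed

end

section \<open>Rays and bouquets\<close>

lemma equiv_ray_equiv: "equiv {g. geodesic_ray g} (ray_equiv :: ((real \<Rightarrow> 'a::metric_space) \<times> _) set)"
proof (rule equivI)
  show "refl_on {g. geodesic_ray g} (ray_equiv :: ((real \<Rightarrow> 'a) \<times> _) set)"
    by (auto simp: refl_on_def ray_equiv_def intro!: bdd_aboveI[where M=0])
  show "sym (ray_equiv :: ((real \<Rightarrow> 'a) \<times> _) set)"
    by (auto simp: sym_def ray_equiv_def dist_commute)
  show "trans (ray_equiv :: ((real \<Rightarrow> 'a) \<times> _) set)"
  proof (rule transI)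
    fix f g h :: "real \<Rightarrow> 'a"
    assume "(f, g) \<in> ray_equiv" "(g, h) \<in> ray_equiv"
    then obtain K K' where rays: "geodesic_ray f" "geodesic_ray h"
      and K: "\<And>t. 0 \<le> t \<Longrightarrow> dist (f t) (g t) \<le> K" "\<And>t. 0 \<le> t \<Longrightarrow> dist (g t) (h t) \<le> K'"
      by (auto simp: ray_equiv_def bdd_above_def)
    have "dist (f t) (h t) \<le> K + K'" if "0 \<le> t" for t
      using K[OF that] dist_triangle[of "f t" "h t" "g t"] by simp
    then show "(f, h) \<in> ray_equiv"
      using rays by (auto simp: ray_equiv_def intro!: bdd_aboveI[where M="K + K'"])
  qed
qed (auto simp: ray_equiv_def)

lemma ray_equivI:
  "geodesic_ray g \<Longrightarrow> geodesic_ray h \<Longrightarrow> (\<And>t. 0 \<le> t \<Longrightarrow> dist (g t) (h t) \<le> K) \<Longrightarrow> (g, h) \<in> ray_equiv"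
  by (auto simp: ray_equiv_def intro!: bdd_aboveI[where M=K])

lemma bouquet_length_exceeds:
  assumes "bouquet (L, \<beta>)"
  shows "\<exists>n\<ge>1. t \<le> L n"
proof -
  have "filterlim L at_top sequentially"
    using assms by (auto simp: bouquet_def cD_bouquet_def)
  then have "eventually (\<lambda>n. t \<le> L n \<and> 1 \<le> n) sequentially"
    by (intro eventually_conj eventually_ge_at_top) (simp add: filterlim_at_top)
  then show ?thesis by (auto simp: eventually_sequentially)
qed

lemma bouquet_asymptoticI:
  assumes "bouquet (L, \<beta>)" "bouquet (L', \<beta>')"
    and "\<And>m n t. \<lbrakk>1 \<le> m; 1 \<le> n; 0 \<le> t; t \<le> L m; t \<le> L' n\<rbrakk> \<Longrightarrow> dist (\<beta> m t) (\<beta>' n t) \<le> K"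
  shows "((L, \<beta>), (L', \<beta>')) \<in> bouquet_asymptotic"
proof -
  have "\<forall>m\<ge>1. \<forall>n\<ge>1. \<forall>t. 0 \<le> t \<and> t \<le> min (L m) (L' n) \<longrightarrow> dist (\<beta> m t) (\<beta>' n t) \<le> max K 0"
    using assms(3) by (force simp: le_max_iff_disj)
  then show ?thesis
    using assms(1,2) unfolding bouquet_asymptotic_def by (auto intro!: exI[of _ "max K 0"])
qed

lemma bouquet_asymptoticE:
  assumes "((L, \<beta>), (L', \<beta>')) \<in> bouquet_asymptotic"
  obtains K where "bouquet (L, \<beta>)" "bouquet (L', \<beta>')"
    "\<And>m n t. \<lbrakk>1 \<le> m; 1 \<le> n; 0 \<le> t; t \<le> L m; t \<le> L' n\<rbrakk> \<Longrightarrow> dist (\<beta> m t) (\<beta>' n t) \<le> K"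
  using assms unfolding bouquet_asymptotic_def by auto

text \<open>Reflexivity is the bouquet condition made symmetric in the two indices. For transitivity
  the middle bouquet must have a segment that reaches \<open>t\<close>; one exists because its
  lengths tend to infinity.\<close>

lemma equiv_bouquet_asymptotic:
  "equiv {B. bouquet B} (bouquet_asymptotic :: ('a::metric_space path_seq \<times> _) set)"
proof (rule equivI)
  show "refl_on {B. bouquet B} (bouquet_asymptotic :: ('a path_seq \<times> _) set)"
  proof (rule refl_onI)
    fix B :: "'a path_seq"
    assume "B \<in> {B. bouquet B}"
    moreover obtain L \<beta> where B: "B = (L, \<beta>)" by fastforce
    ultimately have bq: "bouquet (L, \<beta>)" by simp
    then obtain c D p where "cD_bouquet c D p (L, \<beta>)"
      unfolding bouquet_def by blast
    then have c: "dist (\<beta> m t) (\<beta> n t) \<le> c" if "1 \<le> m" "m \<le> n" "0 \<le> t" "t \<le> L m" for m n t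
      using that by (simp add: cD_bouquet_def)
    show "(B, B) \<in> bouquet_asymptotic"
      unfolding B
    proof (rule bouquet_asymptoticI[OF bq bq])
      fix m n :: nat and t :: real
      assume "1 \<le> m" "1 \<le> n" "0 \<le> t" "t \<le> L m" "t \<le> L n"
      then show "dist (\<beta> m t) (\<beta> n t) \<le> c"
        using c[of m n t] c[of n m t] by (cases "m \<le> n") (auto simp: dist_commute)
    qed
  qed
  show "sym (bouquet_asymptotic :: ('a path_seq \<times> _) set)"
  proof (rule symI)
    fix B B' :: "'a path_seq"
    assume "(B, B') \<in> bouquet_asymptotic"
    moreover obtain L \<beta> L' \<beta>' where B: "B = (L, \<beta>)" "B' = (L', \<beta>')" by fastforce
    ultimately obtain K where "bouquet (L, \<beta>)" "bouquet (L', \<beta>')"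
      "\<And>m n t. \<lbrakk>1 \<le> m; 1 \<le> n; 0 \<le> t; t \<le> L m; t \<le> L' n\<rbrakk> \<Longrightarrow> dist (\<beta> m t) (\<beta>' n t) \<le> K"
      using bouquet_asymptoticE by metis
    then show "(B', B) \<in> bouquet_asymptotic"
      unfolding B by (intro bouquet_asymptoticI[where K=K]) (auto simp: dist_commute)
  qed
  show "trans (bouquet_asymptotic :: ('a path_seq \<times> _) set)"
  proof (rule transI)
    fix B1 B2 B3 :: "'a path_seq"
    assume as: "(B1, B2) \<in> bouquet_asymptotic" "(B2, B3) \<in> bouquet_asymptotic"
    obtain L1 \<beta>1 L2 \<beta>2 L3 \<beta>3 where B: "B1 = (L1, \<beta>1)" "B2 = (L2, \<beta>2)" "B3 = (L3, \<beta>3)"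
      by fastforce
    obtain K where K: "bouquet (L1, \<beta>1)" "bouquet (L2, \<beta>2)"
      "\<And>m n t. \<lbrakk>1 \<le> m; 1 \<le> n; 0 \<le> t; t \<le> L1 m; t \<le> L2 n\<rbrakk> \<Longrightarrow> dist (\<beta>1 m t) (\<beta>2 n t) \<le> K"
      using as(1) unfolding B by (rule bouquet_asymptoticE) blast
    obtain K' where K': "bouquet (L3, \<beta>3)"
      "\<And>m n t. \<lbrakk>1 \<le> m; 1 \<le> n; 0 \<le> t; t \<le> L2 m; t \<le> L3 n\<rbrakk> \<Longrightarrow> dist (\<beta>2 m t) (\<beta>3 n t) \<le> K'"
      using as(2) unfolding B by (rule bouquet_asymptoticE) blast
    show "(B1, B3) \<in> bouquet_asymptotic"
      unfolding B
    proof (rule bouquet_asymptoticI[OF K(1) K'(1)])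
      fix m n :: nat and t :: real
      assume *: "1 \<le> m" "1 \<le> n" "0 \<le> t" "t \<le> L1 m" "t \<le> L3 n"
      obtain k where k: "1 \<le> k" "t \<le> L2 k" using bouquet_length_exceeds[OF K(2)] by blast
      show "dist (\<beta>1 m t) (\<beta>3 n t) \<le> K + K'"
        using K(3)[OF *(1) k(1) *(3,4) k(2)] K'(2)[OF k(1) *(2,3) k(2) *(5)]
          dist_triangle[of "\<beta>1 m t" "\<beta>3 n t" "\<beta>2 k t"] by simp
    qed
  qed
qed (auto simp: bouquet_asymptotic_def)

lemma ray_class_eq_iff:
  "geodesic_ray g \<Longrightarrow> geodesic_ray h \<Longrightarrow> ray_class g = ray_class h \<longleftrightarrow> (g, h) \<in> ray_equiv"
  unfolding ray_class_def by (rule eq_equiv_class_iff[OF equiv_ray_equiv]) auto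

lemma bouquet_class_eq_iff:
  "bouquet B \<Longrightarrow> bouquet B' \<Longrightarrow>
    bouquet_class B = bouquet_class B' \<longleftrightarrow> (B, B') \<in> bouquet_asymptotic"
  unfolding bouquet_class_def by (rule eq_equiv_class_iff[OF equiv_bouquet_asymptotic]) auto

section \<open>Short functions and the bouquet of a ray\<close>

text \<open>This single short function certifies both ray bouquets and standard bouquets as
  bouquets. It is 1-Lipschitz because the reciprocals are taken of numbers that are at least
  1.\<close>

lemma short_function_inverse: "short_function (\<lambda>t. 1 / max 1 t)"
proof -
  have "\<bar>1 / max 1 s - 1 / max 1 t\<bar> \<le> \<bar>s - t\<bar>" for s t :: real
  proof -
    define a b where "a = max 1 s" and "b = max 1 t"
    have ab: "1 \<le> a" "1 \<le> b" by (auto simp: a_def b_def)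
    have "1 / a - 1 / b = (b - a) / (a * b)" using ab by (simp add: field_simps)
    then have "\<bar>1 / a - 1 / b\<bar> = \<bar>b - a\<bar> / (a * b)" using ab by (simp add: abs_mult)
    also have "\<dots> \<le> \<bar>b - a\<bar> / 1"
      using ab mult_mono[of 1 a 1 b] by (intro divide_left_mono) auto
    also have "\<dots> \<le> \<bar>s - t\<bar>" by (auto simp: a_def b_def)
    finally show ?thesis by (simp add: a_def b_def)
  qed
  then show ?thesis
    by (auto simp: short_function_def intro!: divide_left_mono)
qed

lemma short_function_le_inverse:
  assumes "short_function D" "0 \<le> t"
  shows "0 \<le> D t" "D t \<le> 1 / max 1 t"
  using assms unfolding short_function_def by (cases "t > 1"; force simp: max_def less_imp_le)+

lemma std_D_bounds: "0 \<le> std_D t" "0 \<le> t \<Longrightarrow> std_D t \<le> 1 / max 1 t"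
  by (auto simp: std_D_def intro!: divide_left_mono)

lemma cD_bouquet_mono:
  assumes "cD_bouquet c D p B" "\<And>t. 0 \<le> t \<Longrightarrow> D t \<le> D' t"
  shows "cD_bouquet c D' p B"
proof -
  have "D_short D' g L" if "D_short D g L" for g :: "real \<Rightarrow> 'a" and L
    using that assms(2)[of "dist (g 0) (g L)"]
    unfolding D_short_def short_segment_def
    by (auto elim!: order_trans intro!: ennreal_leI)
  then show ?thesis using assms(1) by (auto simp: cD_bouquet_def)
qed

text \<open>Agreement with the ray is asked only on the relevant intervals, so that restricted
  functions qualify. The lemma serves both \<open>ray_bouquet\<close> and the canonical standard
  bouquet over a boundary point.\<close>

lemma isometric_cD_bouquet:
  assumes g: "geodesic_ray g" and c: "0 \<le> c" and D: "\<And>t. 0 \<le> t \<Longrightarrow> 0 \<le> D t"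
    and L: "\<And>n. 1 \<le> n \<Longrightarrow> 0 \<le> L n" "mono_on {1..} L" "filterlim L at_top sequentially"
    and \<beta>: "\<And>n t. \<lbrakk>1 \<le> n; 0 \<le> t; t \<le> L n\<rbrakk> \<Longrightarrow> \<beta> n t = g t"
  shows "cD_bouquet c D (g 0) (L, \<beta>)"
proof -
  have iso: "isometric_path (\<beta> n) (L n)" if "1 \<le> n" for n
    using isometric_path_cong[OF geodesic_ray_isometric[OF g] \<beta>[OF that]] by blast
  have "dist (\<beta> m t) (\<beta> n t) \<le> c" if "1 \<le> m" "m \<le> n" "0 \<le> t" "t \<le> L m" for m n t
  proof -
    have "L m \<le> L n" using that L(2) by (auto simp: mono_on_def)
    then show ?thesis using that \<beta> c by simp
  qed
  then show ?thesis
    using iso L D \<beta>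
    by (auto simp: cD_bouquet_def intro!: isometric_path_unit_speed isometric_path_D_short)
qed

definition ray_bouquet :: "(real \<Rightarrow> 'a::metric_space) \<Rightarrow> 'a path_seq" where
  "ray_bouquet g = (\<lambda>n. real n, \<lambda>n. restrict g {0..real n})"

lemma bouquet_ray_bouquet:
  assumes "geodesic_ray g"
  shows "bouquet (ray_bouquet g)"
proof -
  have "cD_bouquet 0 (\<lambda>t. 1 / max 1 t) (g 0) (ray_bouquet g)"
    unfolding ray_bouquet_def
    by (rule isometric_cD_bouquet[OF assms])
      (auto simp: mono_on_def intro: filterlim_real_sequentially)
  then show ?thesis
    unfolding bouquet_def using short_function_inverse by blast
qed

lemma asymptotic_ray_bouquetI:
  assumes "bouquet (L, \<beta>)" "geodesic_ray g"
    and "\<And>n t. \<lbrakk>1 \<le> n; 0 \<le> t; t \<le> L n\<rbrakk> \<Longrightarrow> dist (g t) (\<beta> n t) \<le> K"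
  shows "((L, \<beta>), ray_bouquet g) \<in> bouquet_asymptotic"
  unfolding ray_bouquet_def
  by (rule bouquet_asymptoticI[where K=K])
    (use assms bouquet_ray_bouquet[OF assms(2)] in \<open>auto simp: ray_bouquet_def dist_commute\<close>)

lemma ray_bouquet_asymptotic_iff:
  assumes "geodesic_ray g" "geodesic_ray h"
  shows "(ray_bouquet g, ray_bouquet h) \<in> bouquet_asymptotic \<longleftrightarrow> (g, h) \<in> ray_equiv"
proof
  assume "(ray_bouquet g, ray_bouquet h) \<in> bouquet_asymptotic"
  then obtain K where K: "\<And>m n t. \<lbrakk>1 \<le> m; 1 \<le> n; 0 \<le> t; t \<le> real m; t \<le> real n\<rbrakk> \<Longrightarrow>
      dist (restrict g {0..real m} t) (restrict h {0..real n} t) \<le> K"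
    unfolding ray_bouquet_def by (rule bouquet_asymptoticE) blast
  show "(g, h) \<in> ray_equiv"
  proof (rule ray_equivI[OF assms])
    fix t :: real assume t: "0 \<le> t"
    obtain n :: nat where "max t 1 \<le> real n" using real_arch_simple by blast
    then show "dist (g t) (h t) \<le> K" using K[of n n t] t by simp
  qed
next
  assume "(g, h) \<in> ray_equiv"
  then obtain K where "\<And>t. 0 \<le> t \<Longrightarrow> dist (g t) (h t) \<le> K"
    by (auto simp: ray_equiv_def bdd_above_def)
  then show "(ray_bouquet g, ray_bouquet h) \<in> bouquet_asymptotic"
    using bouquet_ray_bouquet[OF assms(1)] unfolding ray_bouquet_def[of g]
    by (intro asymptotic_ray_bouquetI[OF _ assms(2), where K=K]) (simp_all add: dist_commute)
qed

section \<open>Uniqueness of rays and the ray near a bouquet\<close>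

context
  assumes cat0: "CAT0 TYPE('a::metric_space)"
begin

text \<open>If the rays stay within \<open>K\<close>, contraction from parameter \<open>T\<close>
  bounds their distance at \<open>t\<close> by \<open>t * K / T\<close>, and \<open>T\<close> is
  arbitrary.\<close>

lemma ray_unique:
  fixes g h :: "real \<Rightarrow> 'a"
  assumes "(g, h) \<in> ray_equiv" "g 0 = h 0" "0 \<le> t"
  shows "g t = h t"
proof (rule ccontr)
  assume neq: "g t \<noteq> h t"
  obtain K where K: "\<And>t. 0 \<le> t \<Longrightarrow> dist (g t) (h t) \<le> K"
    using assms(1) by (auto simp: ray_equiv_def bdd_above_def)
  have rays: "isometric_path g T" "isometric_path h T" for T
    using assms(1) geodesic_ray_isometric by (auto simp: ray_equiv_def)
  have K0: "0 \<le> K" using K[of 0] zero_le_dist[of "g 0" "h 0"] by linarith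
  define T where "T = max (t + 1) (t * K / dist (g t) (h t) + 1)"
  have T: "0 < T" "t \<le> T" using assms(3) by (auto simp: T_def)
  have "dist (g t) (h t) \<le> t / T * dist (g T) (h T)"
    by (rule isometric_path_contraction[OF cat0 rays assms(2,3) T(2,1)])
  also have "\<dots> \<le> t / T * K" using T assms(3) K by (intro mult_left_mono) auto
  finally have "T * dist (g t) (h t) \<le> t * K" using T by (simp add: field_simps)
  moreover have "t * K / dist (g t) (h t) < T" by (simp add: T_def)
  then have "t * K < T * dist (g t) (h t)" using neq by (simp add: pos_divide_less_eq)
  ultimately show False by simp
qed

text \<open>The ray is the limit of the geodesics to the endpoints \<open>x n\<close> of the
  segments. Each endpoint is within \<open>c + 1\<close> of the later geodesics, which contributes
  \<open>2 * (c + 1)\<close>. A further 1 covers the excess of \<open>L n\<close> over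
  \<open>dist p (x n)\<close>, and 2 is the distance between a short path and its geodesic.\<close>

lemma exists_ray_near_bouquet:
  fixes p :: 'a
  assumes complete: "complete (UNIV :: 'a set)" and b: "cD_bouquet c D p (L, \<beta>)" and c: "0 \<le> c"
    and D: "\<And>t. 0 \<le> t \<Longrightarrow> 0 \<le> D t" "\<And>t. 0 \<le> t \<Longrightarrow> D t \<le> 1 / max 1 t"
  shows "\<exists>r. geodesic_ray r \<and> r 0 = p \<and>
    (\<forall>n\<ge>1. \<forall>t. 0 \<le> t \<and> t \<le> L n \<longrightarrow> dist (r t) (\<beta> n t) \<le> 2 * c + 5)"
proof -
  define x where "x = (\<lambda>n. \<beta> n (L n))"
  have seg: "unit_speed (\<beta> n) (L n)" "D_short D (\<beta> n) (L n)" "\<beta> n 0 = p" if "1 \<le> n" for n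
    using b that by (auto simp: cD_bouquet_def)
  have L: "0 \<le> L n" "L n \<le> dist p (x n) + D (dist p (x n))" if "1 \<le> n" for n
    using D_short_length[OF seg(1,2)[OF that]] D(1) seg(3)[OF that] that by (auto simp: x_def)
  have L1: "L n \<le> dist p (x n) + 1" if "1 \<le> n" for n
  proof -
    have "D (dist p (x n)) \<le> 1" using D(2)[of "dist p (x n)"] by (rule order_trans) auto
    then show ?thesis using L(2)[OF that] by simp
  qed
  have dL: "dist p (x n) \<le> L n" if "1 \<le> n" for n
    using unit_speed_dist[OF seg(1)[OF that], of 0 "L n"] L(1) seg(3) that by (simp add: x_def)
  have mono: "L m \<le> L n" if "1 \<le> m" "m \<le> n" for m n
    using b that by (auto simp: cD_bouquet_def mono_on_def)
  have close: "dist (\<beta> m t) (\<beta> n t) \<le> c" if "1 \<le> m" "m \<le> n" "0 \<le> t" "t \<le> L m" for m n t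
    using b that by (auto simp: cD_bouquet_def)
  have near: "dist (\<beta> n s) (geod p (x n) (s / L n * dist p (x n))) \<le> 1"
    "dist (\<beta> n s) (geod p (x n) s) \<le> 2" if "1 \<le> n" "0 \<le> s" "s \<le> L n" for n s
    using short_path_near_geod[OF cat0 seg(1)[OF that(1)], of "D (dist p (x n))" s]
      L(2)[OF that(1)] D seg(3)[OF that(1)] that(2,3) by (auto simp: x_def)
  \<comment> \<open>Indices are shifted by one because entry 0 of a bouquet is meaningless.\<close>
  have "filterlim (\<lambda>n. dist p (x (Suc n))) at_top sequentially"
  proof (rule filterlim_at_top_mono)
    have "filterlim (\<lambda>n. L (Suc n)) at_top sequentially"
      using b by (simp add: cD_bouquet_def filterlim_sequentially_Suc)
    then show "filterlim (\<lambda>n. - 1 + L (Suc n)) at_top sequentially"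
      by (intro filterlim_tendsto_add_at_top[OF tendsto_const])
    have "- 1 + L (Suc n) \<le> dist p (x (Suc n))" for n using L1[of "Suc n"] by simp
    then show "eventually (\<lambda>n. - 1 + L (Suc n) \<le> dist p (x (Suc n))) sequentially" by simp
  qed
  moreover have "\<exists>s. 0 \<le> s \<and> s \<le> dist p (x (Suc n)) \<and>
      dist (x (Suc m)) (geod p (x (Suc n)) s) \<le> c + 1" if "m \<le> n" for m n
  proof -
    \<comment> \<open>Equal fractions are compared because the parameter \<open>L (Suc m)\<close>
      itself may lie beyond the end of the geodesic to \<open>x (Suc n)\<close>.\<close>
    define l where "l = L (Suc m) / L (Suc n)"
    have l: "0 \<le> l" "l \<le> 1"
      using L(1)[of "Suc m"] L(1)[of "Suc n"] mono[of "Suc m" "Suc n"] that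
      by (auto simp: l_def divide_simps)
    have "dist (x (Suc m)) (\<beta> (Suc n) (L (Suc m))) \<le> c"
      unfolding x_def using L(1) that by (intro close) auto
    moreover have "dist (\<beta> (Suc n) (L (Suc m))) (geod p (x (Suc n)) (l * dist p (x (Suc n)))) \<le> 1"
      unfolding l_def using L(1) that mono by (intro near) auto
    ultimately have "dist (x (Suc m)) (geod p (x (Suc n)) (l * dist p (x (Suc n)))) \<le> c + 1"
      using dist_triangle[of "x (Suc m)" "geod p (x (Suc n)) (l * dist p (x (Suc n)))"
          "\<beta> (Suc n) (L (Suc m))"] by linarith
    then show ?thesis
      using l by (intro exI[of _ "l * dist p (x (Suc n))"]) (simp add: mult_left_le_one_le)
  qed
  ultimately obtain r where r: "geodesic_ray r" "r 0 = p" and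
    r_near: "\<And>m t. 0 \<le> t \<Longrightarrow> t \<le> dist p (x (Suc m)) \<Longrightarrow>
      dist (r t) (geod p (x (Suc m)) t) \<le> 2 * (c + 1)"
    using exists_limit_ray[OF cat0 complete, of p "\<lambda>n. x (Suc n)" "c + 1"] by blast
  have "dist (r t) (\<beta> n t) \<le> 2 * c + 5" if n: "1 \<le> n" and t: "0 \<le> t" "t \<le> L n" for n t
  proof -
    obtain m where m: "n = Suc m" using n by (cases n) auto
    define d where "d = dist p (x n)"
    have "dist (r t) (geod p (x n) t) \<le> 2 * c + 3"
    proof (cases "t \<le> d")
      case True
      then show ?thesis using r_near[of t m] t by (simp add: m d_def)
    next
      case False
      have "dist (r t) (r d) \<le> 1"
        using r(1) t False L1[OF n] by (auto simp: geodesic_ray_def d_def)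
      moreover have "dist (r d) (geod p (x n) d) \<le> 2 * (c + 1)"
        using r_near[of d m] by (simp add: d_def m)
      moreover have "geod p (x n) d = geod p (x n) t"
        using False by (simp add: d_def geod_beyond[OF cat0] geod_end[OF cat0])
      ultimately show ?thesis
        using dist_triangle[of "r t" "geod p (x n) t" "r d"] by simp
    qed
    then show ?thesis
      using near(2)[OF n t] dist_triangle2[of "r t" "\<beta> n t" "geod p (x n) t"] by linarith
  qed
  then show ?thesis using r by blast
qed

end

section \<open>The cone topology\<close>

text \<open>A class contains many functions starting at \<open>p\<close>, since values at negative
  arguments are free. By \<open>ray_unique\<close> they agree at all nonnegative ones, so the choice
  is harmless.\<close>

definition ideal_path :: "'a::metric_space \<Rightarrow> 'a + (real \<Rightarrow> 'a) set \<Rightarrow> real \<Rightarrow> 'a" where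
  "ideal_path p y = (case y of Inl x \<Rightarrow> geod p x | Inr \<xi> \<Rightarrow> (SOME g. g \<in> \<xi> \<and> g 0 = p))"

text \<open>The representative may start anywhere, so the map makes no reference to a base
  point.\<close>

definition boundary_map ::
  "'a::metric_space + (real \<Rightarrow> 'a) set \<Rightarrow> 'a + 'a path_seq set" where
  "boundary_map y = (case y of Inl x \<Rightarrow> Inl x
     | Inr \<xi> \<Rightarrow> Inr (bouquet_class (ray_bouquet (SOME g. g \<in> \<xi>))))"

lemma boundary_map_Inl [simp]: "boundary_map (Inl x) = Inl x"
  by (simp add: boundary_map_def)

lemma ray_class_self: "geodesic_ray g \<Longrightarrow> g \<in> ray_class g"
  unfolding ray_class_def by (rule equiv_class_self[OF equiv_ray_equiv]) auto

lemma ray_classD: "h \<in> ray_class g \<Longrightarrow> (g, h) \<in> ray_equiv"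
  by (simp add: ray_class_def)

lemma ray_class_in_ideal_boundary: "geodesic_ray g \<Longrightarrow> ray_class g \<in> ideal_boundary"
  by (auto simp: ideal_boundary_def ray_class_def intro: quotientI)

lemma boundary_map_ray_class:
  assumes g: "geodesic_ray g"
  shows "boundary_map (Inr (ray_class g)) = Inr (bouquet_class (ray_bouquet g))"
proof -
  define h where "h = (SOME h. h \<in> ray_class g)"
  have "h \<in> ray_class g" unfolding h_def by (rule someI[of _ g]) (rule ray_class_self[OF g])
  then have gh: "(g, h) \<in> ray_equiv" by (rule ray_classD)
  then have "geodesic_ray h" by (simp add: ray_equiv_def)
  then have "bouquet_class (ray_bouquet g) = bouquet_class (ray_bouquet h)"
    using gh g
    by (simp add: bouquet_class_eq_iff bouquet_ray_bouquet ray_bouquet_asymptotic_iff)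
  then show ?thesis by (simp add: boundary_map_def h_def)
qed

lemma Inl_mem_Inl_image [simp]: "Inl x \<in> Inl ` A \<longleftrightarrow> x \<in> A"
  by auto

lemma Inr_mem_Inl_image [simp]: "Inr x \<notin> Inl ` A"
  by auto

lemma Inl_in_ideal_space [simp]: "Inl x \<in> ideal_space"
  by (auto simp: ideal_space_def)

lemma Inr_in_ideal_space [simp]: "Inr \<xi> \<in> ideal_space \<longleftrightarrow> \<xi> \<in> ideal_boundary"
  by (auto simp: ideal_space_def)

context
  fixes p :: "'a::metric_space"
  assumes complete: "complete (UNIV :: 'a set)" and cat0: "CAT0 TYPE('a)"
begin

lemma ideal_path_Inr:
  assumes "\<xi> \<in> ideal_boundary"
  shows "geodesic_ray (ideal_path p (Inr \<xi>))" "ideal_path p (Inr \<xi>) 0 = p"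
    "ray_class (ideal_path p (Inr \<xi>)) = \<xi>"
proof -
  obtain g where g: "geodesic_ray g" "\<xi> = ray_class g"
    using assms by (auto simp: ideal_boundary_def ray_class_def elim!: quotientE)
  obtain r where r: "geodesic_ray r" "r 0 = p" "\<And>t. 0 \<le> t \<Longrightarrow> dist (r t) (g t) \<le> 5 * dist p (g 0)"
    using asymptotic_ray_from[OF cat0 complete g(1), of p] by blast
  have "r \<in> \<xi> \<and> r 0 = p"
    unfolding g(2) ray_class_def using r
    by (auto intro!: ray_equivI[OF g(1) r(1)] simp: dist_commute)
  then have "ideal_path p (Inr \<xi>) \<in> \<xi> \<and> ideal_path p (Inr \<xi>) 0 = p"
    unfolding ideal_path_def sum.case by (rule someI[of "\<lambda>g. g \<in> \<xi> \<and> g 0 = p"])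
  then have *: "(g, ideal_path p (Inr \<xi>)) \<in> ray_equiv" and "ideal_path p (Inr \<xi>) 0 = p"
    by (auto simp: g(2) dest: ray_classD)
  then show ray: "geodesic_ray (ideal_path p (Inr \<xi>))" and "ideal_path p (Inr \<xi>) 0 = p"
    by (auto simp: ray_equiv_def)
  show "ray_class (ideal_path p (Inr \<xi>)) = \<xi>"
    using ray_class_eq_iff[OF g(1) ray] * g(2) by simp
qed

lemma ideal_path_ray_class:
  assumes "geodesic_ray g" "g 0 = p" "0 \<le> t"
  shows "ideal_path p (Inr (ray_class g)) t = g t"
proof -
  note h = ideal_path_Inr[OF ray_class_in_ideal_boundary[OF assms(1)]]
  have "(ideal_path p (Inr (ray_class g)), g) \<in> ray_equiv"
    using h(3) ray_class_eq_iff[OF h(1) assms(1)] by (rule iffD1[rotated])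
  then show ?thesis
    by (rule ray_unique[OF cat0]) (simp_all add: h(2) assms(2,3))
qed

lemma ideal_path_0: "y \<in> ideal_space \<Longrightarrow> ideal_path p y 0 = p"
  using ideal_path_Inr(2) geod_0[OF cat0]
  by (cases y) (auto simp: ideal_path_def[of p "Inl _"])

lemma ideal_path_isometric:
  assumes "y \<in> ideal_space - Inl ` ball p T"
  shows "isometric_path (ideal_path p y) T"
proof (cases y)
  case (Inl x)
  then show ?thesis
    using assms geod_isometric[OF cat0, of T p x] by (auto simp: ideal_path_def)
next
  case (Inr \<xi>)
  then show ?thesis
    using assms ideal_path_Inr(1) by (simp add: geodesic_ray_isometric)
qed

lemma ideal_path_lipschitz:
  assumes "y \<in> ideal_space" "0 \<le> s" "0 \<le> t"
  shows "dist (ideal_path p y s) (ideal_path p y t) \<le> \<bar>s - t\<bar>"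
proof (cases y)
  case (Inl x)
  then show ?thesis
    using geod_lipschitz[OF cat0 assms(2,3)] by (simp add: ideal_path_def)
next
  case (Inr \<xi>)
  then show ?thesis
    using assms ideal_path_Inr(1)[of \<xi>] by (simp add: geodesic_ray_def)
qed

lemma ideal_path_contraction:
  assumes "y \<in> ideal_space - Inl ` ball p T" "z \<in> ideal_space - Inl ` ball p T"
    and "0 \<le> t" "t \<le> T" "0 < T"
  shows "dist (ideal_path p y t) (ideal_path p z t) \<le>
    t / T * dist (ideal_path p y T) (ideal_path p z T)"
  using assms
  by (intro isometric_path_contraction[OF cat0] ideal_path_isometric) (auto simp: ideal_path_0)

lemma ideal_path_contraction_le:
  assumes "y \<in> ideal_space - Inl ` ball p T" "z \<in> ideal_space - Inl ` ball p T"
    and "0 \<le> t" "t \<le> T" "0 < T"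
  shows "dist (ideal_path p y t) (ideal_path p z t) \<le> dist (ideal_path p y T) (ideal_path p z T)"
proof -
  have "t / T * dist (ideal_path p y T) (ideal_path p z T) \<le>
      1 * dist (ideal_path p y T) (ideal_path p z T)"
    using assms by (intro mult_right_mono) auto
  then show ?thesis using ideal_path_contraction[OF assms] by simp
qed

text \<open>Uniqueness of geodesics, and of asymptotic rays from \<open>p\<close>, gives the
  definite descriptions in \<open>cone_proj\<close> their meaning.\<close>

lemma cone_proj_eq_ideal_path:
  assumes "y \<in> ideal_space - Inl ` ball p t" "0 \<le> t"
  shows "cone_proj p t y = ideal_path p y t"
proof (cases y)
  case (Inl x)
  then have "t \<le> dist p x" using assms by auto
  then have "(THE z. \<exists>g. geodesic_segment g p x \<and> z = g t) = geod p x t"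
    using assms geod_segment[OF cat0, of p x] geodesic_unique[OF cat0 _ geod_segment[OF cat0]]
    by (intro the_equality) blast+
  then show ?thesis by (simp add: Inl cone_proj_def ideal_path_def)
next
  case (Inr \<xi>)
  then have \<xi>: "\<xi> \<in> ideal_boundary" using assms by auto
  note h = ideal_path_Inr[OF \<xi>]
  have "(THE z. \<exists>g\<in>\<xi>. g 0 = p \<and> z = g t) = ideal_path p (Inr \<xi>) t"
  proof (rule the_equality)
    show "\<exists>g\<in>\<xi>. g 0 = p \<and> ideal_path p (Inr \<xi>) t = g t"
      using h ray_class_self[OF h(1)] by auto
    fix z assume "\<exists>g\<in>\<xi>. g 0 = p \<and> z = g t"
    then obtain g where g: "g \<in> ray_class (ideal_path p (Inr \<xi>))" "g 0 = p" "z = g t"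
      using h(3) by auto
    then show "z = ideal_path p (Inr \<xi>) t"
      using ray_unique[OF cat0 ray_classD[OF g(1)]] h(2) assms(2) by simp
  qed
  then show ?thesis by (simp add: Inr cone_proj_def)
qed

lemma mem_cone_nbhd:
  assumes "\<xi> \<in> ideal_boundary" "0 < t"
  shows "y \<in> cone_nbhd p \<xi> r t \<longleftrightarrow> y \<in> ideal_space - Inl ` ball p t \<and>
    dist (ideal_path p (Inr \<xi>) t) (ideal_path p y t) < r"
proof -
  have "cone_proj p t (Inr \<xi>) = ideal_path p (Inr \<xi>) t"
    using assms by (intro cone_proj_eq_ideal_path) auto
  moreover have "y \<in> ideal_space - Inl ` ball p t \<Longrightarrow> cone_proj p t y = ideal_path p y t"
    using assms by (intro cone_proj_eq_ideal_path) auto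
  ultimately show ?thesis
    unfolding cone_nbhd_def mem_Collect_eq by metis
qed

text \<open>By contraction, paths that are close at \<open>t'\<close> are at least as close at
  \<open>t\<close>. Two basic neighbourhoods of a boundary point therefore contain a common
  one.\<close>

lemma cone_nbhd_antimono:
  assumes "\<xi> \<in> ideal_boundary" "0 < t" "t \<le> t'" "r' \<le> r"
  shows "cone_nbhd p \<xi> r' t' \<subseteq> cone_nbhd p \<xi> r t"
proof
  fix y assume "y \<in> cone_nbhd p \<xi> r' t'"
  then have y: "y \<in> ideal_space - Inl ` ball p t'"
    "dist (ideal_path p (Inr \<xi>) t') (ideal_path p y t') < r'"
    using assms mem_cone_nbhd[of \<xi> t'] by auto
  have "dist (ideal_path p (Inr \<xi>) t) (ideal_path p y t) \<le>
      dist (ideal_path p (Inr \<xi>) t') (ideal_path p y t')"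
    using assms y(1) by (intro ideal_path_contraction_le) auto
  moreover have "y \<in> ideal_space - Inl ` ball p t"
    using y(1) assms(3) by auto
  ultimately show "y \<in> cone_nbhd p \<xi> r t"
    using y(2) assms by (simp add: mem_cone_nbhd)
qed

lemma openin_cone_topology:
  "openin (cone_topology p) U \<longleftrightarrow> U \<subseteq> ideal_space \<and>
     (\<forall>x. Inl x \<in> U \<longrightarrow> (\<exists>r>0. Inl ` ball x r \<subseteq> U)) \<and>
     (\<forall>\<xi>. Inr \<xi> \<in> U \<longrightarrow> (\<exists>r>0. \<exists>t>0. cone_nbhd p \<xi> r t \<subseteq> U))"
  (is "_ \<longleftrightarrow> ?P U")
proof -
  have "istopology ?P"
    unfolding istopology_def
  proof (intro conjI allI impI)
    fix S T x assume "?P S" "?P T" and x: "Inl x \<in> S \<inter> T"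
    then obtain r r' where r: "r > 0" "Inl ` ball x r \<subseteq> S" "r' > 0" "Inl ` ball x r' \<subseteq> T"
      by (metis IntE)
    have "Inl ` ball x (min r r') \<subseteq> S \<inter> T"
      using r(2,4) by (auto simp: image_subset_iff)
    then show "\<exists>r>0. Inl ` ball x r \<subseteq> S \<inter> T"
      using r by (intro exI[of _ "min r r'"]) auto
  next
    fix S T \<xi> assume ST: "?P S" "?P T" and \<xi>: "Inr \<xi> \<in> S \<inter> T"
    then obtain r t where 1: "r > 0" "t > 0" "cone_nbhd p \<xi> r t \<subseteq> S" by (metis IntE)
    obtain r' t' where 2: "r' > 0" "t' > 0" "cone_nbhd p \<xi> r' t' \<subseteq> T" using ST \<xi> by (metis IntE)
    have "\<xi> \<in> ideal_boundary"
      using subsetD[OF ST(1)[THEN conjunct1], of "Inr \<xi>"] \<xi> by simp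
    then have "cone_nbhd p \<xi> (min r r') (max t t') \<subseteq> S \<inter> T"
      using cone_nbhd_antimono[of \<xi> t "max t t'" "min r r'" r]
        cone_nbhd_antimono[of \<xi> t' "max t t'" "min r r'" r'] 1 2 by auto
    then show "\<exists>r>0. \<exists>t>0. cone_nbhd p \<xi> r t \<subseteq> S \<inter> T"
      using 1 2 by (intro exI[of _ "min r r'"] conjI exI[of _ "max t t'"]) auto
  next
    fix S T assume "?P S" "?P T"
    then show "S \<inter> T \<subseteq> ideal_space" by blast
  next
    fix K x assume K: "\<forall>S\<in>K. ?P S" "Inl x \<in> \<Union>K"
    then obtain S where "S \<in> K" "Inl x \<in> S" by blast
    then show "\<exists>r>0. Inl ` ball x r \<subseteq> \<Union>K" using K(1) by (meson Union_upper order_trans)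
  next
    fix K \<xi> assume K: "\<forall>S\<in>K. ?P S" "Inr \<xi> \<in> \<Union>K"
    then obtain S where "S \<in> K" "Inr \<xi> \<in> S" by blast
    then show "\<exists>r>0. \<exists>t>0. cone_nbhd p \<xi> r t \<subseteq> \<Union>K" using K(1) by (meson Union_upper order_trans)
  next
    fix K assume "\<forall>S\<in>K. ?P S"
    then show "\<Union>K \<subseteq> ideal_space" by (intro Union_least) (drule (1) bspec, erule conjunct1)
  qed
  then show ?thesis
    unfolding cone_topology_def by (simp add: topology_inverse')
qed

lemma topspace_cone_topology: "topspace (cone_topology p) = ideal_space"
proof
  have "openin (cone_topology p) ideal_space"
    unfolding openin_cone_topology
    by (auto simp: cone_nbhd_def intro: exI[of _ "1::real"])
  then show "ideal_space \<subseteq> topspace (cone_topology p)" by (rule openin_subset)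
  show "topspace (cone_topology p) \<subseteq> ideal_space"
    using openin_topspace[of "cone_topology p"] unfolding openin_cone_topology by blast
qed

section \<open>The bijection between the two spaces\<close>

lemma inj_on_boundary_map: "inj_on boundary_map (ideal_space :: ('a + (real \<Rightarrow> 'a) set) set)"
proof (rule inj_onI)
  fix y z :: "'a + (real \<Rightarrow> 'a) set"
  assume yz: "y \<in> ideal_space" "z \<in> ideal_space" "boundary_map y = boundary_map z"
  show "y = z"
  proof (cases "\<exists>\<xi> \<eta>. y = Inr \<xi> \<and> z = Inr \<eta>")
    case True
    then obtain \<xi> \<eta> where *: "y = Inr \<xi>" "z = Inr \<eta>" "\<xi> \<in> ideal_boundary" "\<eta> \<in> ideal_boundary"
      using yz by auto
    let ?g = "ideal_path p (Inr \<xi>)" and ?h = "ideal_path p (Inr \<eta>)"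
    note g = ideal_path_Inr[OF *(3)] and h = ideal_path_Inr[OF *(4)]
    have "bouquet_class (ray_bouquet ?g) = bouquet_class (ray_bouquet ?h)"
      using yz(3) boundary_map_ray_class[OF g(1)] boundary_map_ray_class[OF h(1)] g(3) h(3) *
      by simp
    then have "(?g, ?h) \<in> ray_equiv"
      using g(1) h(1)
      by (simp add: bouquet_class_eq_iff bouquet_ray_bouquet ray_bouquet_asymptotic_iff)
    then show ?thesis
      using ray_class_eq_iff[OF g(1) h(1)] g(3) h(3) * by simp
  next
    case False
    then show ?thesis using yz(3) by (cases y; cases z) (auto simp: boundary_map_def)
  qed
qed

lemma boundary_map_surj:
  "boundary_map ` ideal_space = (bouquet_space :: ('a + 'a path_seq set) set)"
proof (intro equalityI subsetI)
  fix z :: "'a + 'a path_seq set"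
  assume "z \<in> boundary_map ` ideal_space"
  then obtain y where y: "y \<in> ideal_space" "z = boundary_map y" by blast
  show "z \<in> bouquet_space"
  proof (cases y)
    case (Inl x)
    then show ?thesis using y by (auto simp: bouquet_space_def)
  next
    case (Inr \<xi>)
    then have g: "geodesic_ray (ideal_path p (Inr \<xi>))" "ray_class (ideal_path p (Inr \<xi>)) = \<xi>"
      using y ideal_path_Inr by auto
    show ?thesis
      using boundary_map_ray_class[OF g(1)] g(2) y Inr bouquet_ray_bouquet[OF g(1)]
      by (auto simp: bouquet_space_def bouquet_boundary_def bouquet_class_def intro!: quotientI)
  qed
next
  fix z :: "'a + 'a path_seq set"
  assume "z \<in> bouquet_space"
  then consider x where "z = Inl x" | B where "bouquet B" "z = Inr (bouquet_class B)"
    by (auto simp: bouquet_space_def bouquet_boundary_def bouquet_class_def elim!: quotientE)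
  then show "z \<in> boundary_map ` ideal_space"
  proof cases
    case (1 x)
    then show ?thesis by (intro image_eqI[of _ _ "Inl x"]) auto
  next
    case (2 B)
    obtain L \<beta> where B: "B = (L, \<beta>)" by fastforce
    obtain c D q where b: "0 \<le> c" "short_function D" "cD_bouquet c D q (L, \<beta>)"
      using 2(1) unfolding B bouquet_def by blast
    \<comment> \<open>The ray is taken from the initial point \<open>q\<close> of the bouquet. It
      need not be moved to \<open>p\<close>, because \<open>boundary_map\<close> can be evaluated on
      any representative.\<close>
    obtain r where r: "geodesic_ray r"
      "\<And>n t. \<lbrakk>1 \<le> n; 0 \<le> t; t \<le> L n\<rbrakk> \<Longrightarrow> dist (r t) (\<beta> n t) \<le> 2 * c + 5"
      using exists_ray_near_bouquet[OF cat0 complete b(3,1)] short_function_le_inverse[OF b(2)]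
      by blast
    have "(B, ray_bouquet r) \<in> bouquet_asymptotic"
      unfolding B
      by (rule asymptotic_ray_bouquetI[OF _ r(1)]) (use r(2) 2(1) B in auto)
    then have "bouquet_class B = bouquet_class (ray_bouquet r)"
      using bouquet_class_eq_iff[OF 2(1) bouquet_ray_bouquet[OF r(1)]] by simp
    then have "z = boundary_map (Inr (ray_class r))"
      using boundary_map_ray_class[OF r(1)] 2(2) by simp
    then show ?thesis
      using ray_class_in_ideal_boundary[OF r(1)] by (intro image_eqI) auto
  qed
qed

end

section \<open>The bouquet topology\<close>

lemma mem_bouquet_index [simp]: "(n, t) \<in> bouquet_index C \<longleftrightarrow> 1 \<le> n \<and> 0 \<le> t \<and> t \<le> std_L C n"
  by (simp add: bouquet_index_def)

lemma std_L_pos: "0 < C \<Longrightarrow> 0 < std_L C n"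
  by (simp add: std_L_def)

lemma filterlim_std_L:
  assumes "0 < C"
  shows "filterlim (std_L C) at_top sequentially"
proof (rule filterlim_at_infinity_imp_filterlim_at_top)
  show "filterlim (std_L C) at_infinity sequentially"
    unfolding std_L_def using assms by (intro filterlim_realpow_sequentially_gt1) auto
qed (use std_L_pos[OF assms] in simp)

lemma exists_std_L_ge:
  assumes "0 < C"
  shows "\<exists>n\<ge>1. T \<le> std_L C n"
proof -
  have "eventually (\<lambda>n. T \<le> std_L C n \<and> 1 \<le> n) sequentially"
    using filterlim_std_L[OF assms]
    by (intro eventually_conj eventually_ge_at_top) (simp add: filterlim_at_top)
  then show ?thesis by (auto simp: eventually_sequentially)
qed

text \<open>The whole path is longer than the distance of its ends by at most 1, so no initial piece
  can lose more than that.\<close>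

lemma short_path_dist_start:
  assumes "unit_speed g L" "L \<le> dist (g 0) (g L) + 1" "0 \<le> t" "t \<le> L"
  shows "t - 1 \<le> dist (g 0) (g t)" "dist (g 0) (g t) \<le> t"
  using unit_speed_dist[OF assms(1), of 0 t] unit_speed_dist[OF assms(1), of t L] assms
    dist_triangle[of "g 0" "g L" "g t"] by simp_all

lemma std_D_short_length:
  assumes "unit_speed g L" "D_short std_D g L"
  shows "0 \<le> L" "L \<le> dist (g 0) (g L) + std_D (dist (g 0) (g L))" "L \<le> dist (g 0) (g L) + 1"
proof -
  show "0 \<le> L" and *: "L \<le> dist (g 0) (g L) + std_D (dist (g 0) (g L))"
    using D_short_length[OF assms std_D_bounds(1)] by blast+
  have "std_D (dist (g 0) (g L)) \<le> 1" by (simp add: std_D_def)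
  then show "L \<le> dist (g 0) (g L) + 1" using * by simp
qed

lemma standard_bouquet_dist_start:
  assumes "standard_bouquet C p b" "(n, t) \<in> bouquet_index C"
  shows "t - 1 \<le> dist p (b (n, t))" "dist p (b (n, t)) \<le> t"
proof -
  let ?g = "\<lambda>t. b (n, t)"
  have g: "unit_speed ?g (std_L C n)" "D_short std_D ?g (std_L C n)" "?g 0 = p"
    using assms by (auto simp: standard_bouquet_def as_path_seq_def cD_bouquet_def)
  show "t - 1 \<le> dist p (b (n, t))" "dist p (b (n, t)) \<le> t"
    using short_path_dist_start[OF g(1) std_D_short_length(3)[OF g(1,2)], of t] assms(2) g(3)
    by simp_all
qed

text \<open>While the mother path runs, its point at \<open>t\<close> has distance at least
  \<open>t - 1\<close> from \<open>p\<close>. A coordinate nearer than that has come to rest, so the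
  endpoint can be read off it.\<close>

lemma finite_length_bouquet_bounds:
  assumes "finite_length_bouquet C p x b" "(n, t) \<in> bouquet_index C"
  shows "dist p (b (n, t)) \<le> t" "dist p x + 1 \<le> t \<Longrightarrow> b (n, t) = x"
    "dist p (b (n, t)) < t - 1 \<Longrightarrow> b (n, t) = x"
proof -
  obtain L g where g: "unit_speed g L" "D_short std_D g L" "g 0 = p" "g L = x"
    and b: "b = restrict (\<lambda>(n, t). if t \<le> L then g t else x) (bouquet_index C)"
    using assms(1) by (auto simp: finite_length_bouquet_def mother_bouquet_def)
  note L = std_D_short_length[OF g(1,2)]
  have bt: "b (n, t) = (if t \<le> L then g t else x)" using assms(2) by (simp add: b)
  show "dist p (b (n, t)) \<le> t"
    using short_path_dist_start[OF g(1) L(3), of t] short_path_dist_start[OF g(1) L(3), of L]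
      L(1) assms(2) g(3,4) by (auto simp: bt)
  show "b (n, t) = x" if "dist p x + 1 \<le> t"
  \<comment> \<open>The hypothesis only yields \<open>L \<le> t\<close>. At \<open>t = L\<close> the
    coordinate is still taken from \<open>g\<close>, with value \<open>g L = x\<close>.\<close>
  proof (cases "t = L")
    case True
    then show ?thesis unfolding bt using g(4) by simp
  next
    case False
    then show ?thesis unfolding bt using L(3) that g(3,4) by simp
  qed
  show "b (n, t) = x" if "dist p (b (n, t)) < t - 1"
    using short_path_dist_start(1)[OF g(1) L(3), of t] that assms(2) g(3)
    by (auto simp: bt split: if_splits)
qed

lemma finite_length_bouquet_near_geod:
  fixes p :: "'a::metric_space"
  assumes "CAT0 TYPE('a)" "finite_length_bouquet C p x b" "(n, t) \<in> bouquet_index C"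
  shows "dist (geod p x t) (b (n, t)) \<le> 2"
proof -
  obtain L g where g: "unit_speed g L" "D_short std_D g L" "g 0 = p" "g L = x"
    and b: "b = restrict (\<lambda>(n, t). if t \<le> L then g t else x) (bouquet_index C)"
    using assms(2) by (auto simp: finite_length_bouquet_def mother_bouquet_def)
  note L = std_D_short_length[OF g(1,2)]
  show ?thesis
  proof (cases "t \<le> L")
    case True
    then show ?thesis
      using short_path_near_geod(2)[OF assms(1) g(1) L(2) std_D_bounds, of t] assms(3) g(3,4)
      by (simp add: b dist_commute)
  next
    case False
    have "dist p x \<le> L" using short_path_dist_start(2)[OF g(1) L(3,1)] g(3,4) by simp
    then show ?thesis using False assms(3) by (simp add: b geod_beyond[OF assms(1)])
  qed
qed

context
  fixes p :: "'a::metric_space" and C :: real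
  assumes C: "0 < C"
begin

text \<open>At a large parameter the one rests at \<open>x\<close>, while the other is too far from
  \<open>p\<close>; the summand 2 makes the contradiction strict.\<close>

lemma finite_length_bouquet_not_standard:
  assumes "finite_length_bouquet C p x b"
  shows "\<not> standard_bouquet C p b"
proof
  assume "standard_bouquet C p b"
  moreover obtain n where "1 \<le> n" "dist p x + 2 \<le> std_L C n"
    using exists_std_L_ge[OF C] by blast
  ultimately show False
    using standard_bouquet_dist_start(1)[of C p b n "std_L C n"] std_L_pos[OF C, of n]
      finite_length_bouquet_bounds(2)[OF assms, of n "std_L C n"] by simp
qed

lemma bouquet_proj_finite_length:
  assumes "finite_length_bouquet C p x b"
  shows "bouquet_proj C p b = Inl x"
proof -
  have "x' = x" if "finite_length_bouquet C p x' b" for x'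
  proof -
    obtain n where "1 \<le> n" "max (dist p x) (dist p x') + 1 \<le> std_L C n"
      using exists_std_L_ge[OF C] by blast
    then show ?thesis
      using finite_length_bouquet_bounds(2)[OF assms, of n "std_L C n"]
        finite_length_bouquet_bounds(2)[OF that, of n "std_L C n"] std_L_pos[OF C, of n] by simp
  qed
  then have "(THE x. finite_length_bouquet C p x b) = x"
    using assms by (rule the_equality[rotated])
  then show ?thesis
    using finite_length_bouquet_not_standard[OF assms] by (simp add: bouquet_proj_def)
qed

lemma generalized_bouquets_dist_start:
  assumes "b \<in> generalized_bouquets C p" "(n, t) \<in> bouquet_index C"
  shows "dist p (b (n, t)) \<le> t"
  using assms standard_bouquet_dist_start(2) finite_length_bouquet_bounds(1)
  unfolding generalized_bouquets_def by blast

lemma generalized_bouquets_subset: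
  "generalized_bouquets C p \<subseteq> topspace (bouquet_product C p)"
proof
  fix b assume b: "b \<in> generalized_bouquets C p"
  have "b \<in> extensional (bouquet_index C)"
    using b by (auto simp: generalized_bouquets_def standard_bouquet_def finite_length_bouquet_def)
  moreover have "dist p (b (n, t)) \<le> std_L C n + 1" if "(n, t) \<in> bouquet_index C" for n t
    using generalized_bouquets_dist_start[OF b that] that by simp
  ultimately show "b \<in> topspace (bouquet_product C p)"
    by (auto simp: bouquet_product_def PiE_iff simp del: mem_bouquet_index)
qed

section \<open>Open sets of bouquets in terms of coordinates\<close>

lemma openin_generalized_bouquetsD:
  assumes "openin (subtopology (bouquet_product C p) (generalized_bouquets C p)) S" "b \<in> S"
  shows "\<exists>J d. finite J \<and> J \<subseteq> bouquet_index C \<and> 0 < d \<and>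
    (\<forall>b'\<in>generalized_bouquets C p. (\<forall>i\<in>J. dist (b' i) (b i) < d) \<longrightarrow> b' \<in> S)"
proof -
  let ?X = "\<lambda>(n, t). top_of_set (cball p (std_L C n + 1))"
  obtain V where V: "openin (bouquet_product C p) V" "S = V \<inter> generalized_bouquets C p"
    using assms(1) by (auto simp: openin_subtopology)
  then obtain W where W: "finite {i \<in> bouquet_index C. W i \<noteq> topspace (?X i)}"
    "\<forall>i\<in>bouquet_index C. openin (?X i) (W i)" "b \<in> Pi\<^sub>E (bouquet_index C) W"
    "Pi\<^sub>E (bouquet_index C) W \<subseteq> V"
    using assms(2) unfolding bouquet_product_def openin_product_topology_alt by blast
  define J where "J = {i \<in> bouquet_index C. W i \<noteq> topspace (?X i)}"
  have "\<exists>e>0. \<forall>z \<in> topspace (?X i). dist z (b i) < e \<longrightarrow> z \<in> W i" if i: "i \<in> bouquet_index C" for i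
  proof -
    obtain n t where nt: "i = (n, t)" by fastforce
    have "openin (top_of_set (cball p (std_L C n + 1))) (W i)" "b i \<in> W i"
      using W(2,3) i by (auto simp: nt PiE_iff simp del: mem_bouquet_index)
    then show ?thesis unfolding nt openin_euclidean_subtopology_iff by auto
  qed
  then obtain e where e: "\<And>i. i \<in> bouquet_index C \<Longrightarrow> 0 < e i"
    "\<And>i z. i \<in> bouquet_index C \<Longrightarrow> z \<in> topspace (?X i) \<Longrightarrow> dist z (b i) < e i \<Longrightarrow> z \<in> W i"
    by metis
  \<comment> \<open>Inserting 1 keeps the minimum meaningful when no coordinate is
    restricted.\<close>
  define d where "d = Min (insert 1 (e ` J))"
  have J: "finite J" "J \<subseteq> bouquet_index C" using W(1) by (auto simp: J_def)
  have "0 < d" using J e(1) by (auto simp: d_def)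
  moreover have "b' \<in> S" if b': "b' \<in> generalized_bouquets C p" "\<forall>i\<in>J. dist (b' i) (b i) < d" for b'
  proof -
    have top: "b' \<in> Pi\<^sub>E (bouquet_index C) (\<lambda>i. topspace (?X i))"
      using subsetD[OF generalized_bouquets_subset b'(1)]
      by (simp only: bouquet_product_def topspace_product_topology comp_def)
    have "b' i \<in> W i" if i: "i \<in> bouquet_index C" for i
    proof (cases "i \<in> J")
      case True
      then have "d \<le> e i" using J by (auto simp: d_def)
      then have "dist (b' i) (b i) < e i" using b'(2) True by force
      then show ?thesis by (rule e(2)[OF i PiE_mem[OF top i]])
    next
      case False
      then have "W i = topspace (?X i)" using i by (simp add: J_def)
      then show ?thesis using PiE_mem[OF top i] by simp
    qed
    then have "b' \<in> Pi\<^sub>E (bouquet_index C) W" using top by (simp add: PiE_iff)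
    then have "b' \<in> V" using W(4) by blast
    then show ?thesis using b'(1) V(2) by blast
  qed
  ultimately show ?thesis using J by blast
qed

text \<open>One coordinate suffices here, since a single late parameter separates bouquets well
  enough, both over interior points and over boundary points.\<close>

lemma openin_generalized_bouquetsI:
  assumes "S \<subseteq> generalized_bouquets C p"
    and "\<And>b. b \<in> S \<Longrightarrow> \<exists>i\<in>bouquet_index C. \<exists>d>0.
      \<forall>b'\<in>generalized_bouquets C p. dist (b' i) (b i) < d \<longrightarrow> b' \<in> S"
  shows "openin (subtopology (bouquet_product C p) (generalized_bouquets C p)) S"
proof (subst openin_subopen, intro ballI)
  fix b assume b: "b \<in> S"
  obtain n t d where i: "(n, t) \<in> bouquet_index C" and d: "0 < d"
    "\<And>b'. b' \<in> generalized_bouquets C p \<Longrightarrow> dist (b' (n, t)) (b (n, t)) < d \<Longrightarrow> b' \<in> S"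
    using assms(2)[OF b] by (metis surj_pair)
  let ?B = "cball p (std_L C n + 1)"
  let ?V = "{b' \<in> topspace (bouquet_product C p). b' (n, t) \<in> ?B \<inter> ball (b (n, t)) d}"
  have "continuous_map (bouquet_product C p) (top_of_set ?B) (\<lambda>b'. b' (n, t))"
    using continuous_map_product_projection[OF i, of "\<lambda>(n, t). top_of_set (cball p (std_L C n + 1))"]
    by (simp add: bouquet_product_def)
  moreover have "openin (top_of_set ?B) (?B \<inter> ball (b (n, t)) d)"
    by (simp add: openin_open_Int)
  ultimately have "openin (bouquet_product C p) ?V"
    by (rule openin_continuous_map_preimage)
  then have "openin (subtopology (bouquet_product C p) (generalized_bouquets C p))
      (?V \<inter> generalized_bouquets C p)"
    by (auto simp: openin_subtopology)
  moreover have "b \<in> ?V \<inter> generalized_bouquets C p"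
  proof -
    have "b \<in> generalized_bouquets C p" using b assms(1) by blast
    moreover from this have "b \<in> topspace (bouquet_product C p)"
      using generalized_bouquets_subset by blast
    moreover have "dist p (b (n, t)) \<le> std_L C n + 1"
      using generalized_bouquets_dist_start[OF calculation(1) i] i by simp
    ultimately show ?thesis using d(1) by simp
  qed
  moreover have "?V \<inter> generalized_bouquets C p \<subseteq> S"
    using d(2) by (auto simp: dist_commute)
  ultimately show "\<exists>T. openin (subtopology (bouquet_product C p) (generalized_bouquets C p)) T \<and>
      b \<in> T \<and> T \<subseteq> S"
    by blast
qed

context
  assumes complete: "complete (UNIV :: 'a set)" and cat0: "CAT0 TYPE('a)"
begin

section \<open>Generalized bouquets and the points they represent\<close>

text \<open>The bound is \<open>2 * c + 5\<close> from \<open>exists_ray_near_bouquet\<close> with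
  \<open>c = 2 * C + 2\<close>.\<close>

lemma standard_bouquet_proj:
  assumes "standard_bouquet C p b"
  shows "\<exists>\<xi>\<in>ideal_boundary. bouquet_proj C p b = boundary_map (Inr \<xi>) \<and>
    (\<forall>(n, t)\<in>bouquet_index C. dist (ideal_path p (Inr \<xi>) t) (b (n, t)) \<le> 4 * C + 9)"
proof -
  have b: "cD_bouquet (2 * C + 2) std_D p (std_L C, \<lambda>n t. b (n, t))"
    using assms by (simp add: standard_bouquet_def as_path_seq_def)
  have bq: "bouquet (std_L C, \<lambda>n t. b (n, t))"
    using cD_bouquet_mono[OF b std_D_bounds(2)] short_function_inverse C
    unfolding bouquet_def by (intro exI[of _ "2 * C + 2"] exI conjI) auto
  obtain r where r: "geodesic_ray r" "r 0 = p"
    "\<And>n t. 1 \<le> n \<Longrightarrow> 0 \<le> t \<Longrightarrow> t \<le> std_L C n \<Longrightarrow> dist (r t) (b (n, t)) \<le> 2 * (2 * C + 2) + 5"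
    using exists_ray_near_bouquet[OF cat0 complete b _ std_D_bounds] C by auto
  have "((std_L C, \<lambda>n t. b (n, t)), ray_bouquet r) \<in> bouquet_asymptotic"
    by (rule asymptotic_ray_bouquetI[OF bq r(1,3)])
  then have "bouquet_class (as_path_seq C b) = bouquet_class (ray_bouquet r)"
    using bouquet_class_eq_iff[OF bq bouquet_ray_bouquet[OF r(1)]] by (simp add: as_path_seq_def)
  then have "bouquet_proj C p b = boundary_map (Inr (ray_class r))"
    using boundary_map_ray_class[OF r(1)] assms by (simp add: bouquet_proj_def)
  moreover have "dist (ideal_path p (Inr (ray_class r)) t) (b (n, t)) \<le> 4 * C + 9"
    if "(n, t) \<in> bouquet_index C" for n t
    using r(3)[of n t] that ideal_path_ray_class[OF complete cat0 r(1,2)] by simp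
  ultimately show ?thesis
    using ray_class_in_ideal_boundary[OF r(1)] by blast
qed

lemma generalized_bouquet_proj:
  assumes "b \<in> generalized_bouquets C p"
  obtains y where "y \<in> ideal_space" "bouquet_proj C p b = boundary_map y"
    "\<And>n t. (n, t) \<in> bouquet_index C \<Longrightarrow> dist (ideal_path p y t) (b (n, t)) \<le> 4 * C + 9"
proof (cases "standard_bouquet C p b")
  case True
  then obtain \<xi> where "\<xi> \<in> ideal_boundary" "bouquet_proj C p b = boundary_map (Inr \<xi>)"
    "\<forall>(n, t)\<in>bouquet_index C. dist (ideal_path p (Inr \<xi>) t) (b (n, t)) \<le> 4 * C + 9"
    using standard_bouquet_proj by blast
  then show ?thesis by (intro that[of "Inr \<xi>"]) (auto simp del: mem_bouquet_index)
next
  case False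
  then obtain x where x: "finite_length_bouquet C p x b"
    using assms by (auto simp: generalized_bouquets_def)
  show ?thesis
  proof (rule that[of "Inl x"])
    show "bouquet_proj C p b = boundary_map (Inl x)"
      using bouquet_proj_finite_length[OF x] by simp
    show "dist (ideal_path p (Inl x) t) (b (n, t)) \<le> 4 * C + 9" if "(n, t) \<in> bouquet_index C" for n t
      using finite_length_bouquet_near_geod[OF cat0 x that] C by (simp add: ideal_path_def)
  qed simp
qed

lemma topspace_bouquet_topology: "topspace (bouquet_topology C p) = bouquet_space"
proof
  let ?T = "subtopology (bouquet_product C p) (generalized_bouquets C p)"
  have "bouquet_proj C p b \<in> bouquet_space" if "b \<in> topspace ?T" for b
  proof -
    have "b \<in> generalized_bouquets C p" using that by simp
    then obtain y :: "'a + (real \<Rightarrow> 'a) set"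
      where "y \<in> ideal_space" "bouquet_proj C p b = boundary_map y"
      by (rule generalized_bouquet_proj) blast
    then show ?thesis
      using boundary_map_surj[OF complete cat0] by blast
  qed
  then have "{b \<in> topspace ?T. bouquet_proj C p b \<in> bouquet_space} = topspace ?T" by blast
  then have "openin (bouquet_topology C p) bouquet_space"
    unfolding bouquet_topology_def openin_quotient_topology using openin_topspace[of ?T] by simp
  then show "bouquet_space \<subseteq> topspace (bouquet_topology C p)" by (rule openin_subset)
  show "topspace (bouquet_topology C p) \<subseteq> bouquet_space"
    using openin_topspace[of "bouquet_topology C p"]
    unfolding bouquet_topology_def openin_quotient_topology by (rule conjunct1)
qed

lemma openin_bouquet_topology_image:
  assumes "U \<subseteq> ideal_space"
  shows "openin (bouquet_topology C p) (boundary_map ` U) \<longleftrightarrow>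
    openin (subtopology (bouquet_product C p) (generalized_bouquets C p))
      {b \<in> generalized_bouquets C p. bouquet_proj C p b \<in> boundary_map ` U}"
proof -
  have "topspace (subtopology (bouquet_product C p) (generalized_bouquets C p)) =
      generalized_bouquets C p"
    using generalized_bouquets_subset by auto
  moreover have "boundary_map ` U \<subseteq> bouquet_space"
    using assms boundary_map_surj[OF complete cat0] by blast
  ultimately show ?thesis
    unfolding bouquet_topology_def openin_quotient_topology by simp
qed

text \<open>Up to \<open>boundary_map\<close> this is a section of the quotient map. Its coordinates
  are values of \<open>ideal_path\<close>, so continuity in \<open>y\<close> can be checked on the
  paths.\<close>

definition canonical_bouquet :: "'a + (real \<Rightarrow> 'a) set \<Rightarrow> nat \<times> real \<Rightarrow> 'a" where
  "canonical_bouquet y = restrict (\<lambda>(n, t). ideal_path p y t) (bouquet_index C)"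

lemma canonical_bouquet:
  assumes "y \<in> ideal_space"
  shows "canonical_bouquet y \<in> generalized_bouquets C p"
    "bouquet_proj C p (canonical_bouquet y) = boundary_map y"
proof -
  have "canonical_bouquet y \<in> generalized_bouquets C p \<and>
    bouquet_proj C p (canonical_bouquet y) = boundary_map y"
  proof (cases y)
    case (Inl x)
    have iso: "isometric_path (geod p x) (dist p x)"
      by (rule geod_isometric[OF cat0 order_refl])
    have "mother_bouquet p x (dist p x) (geod p x)"
      unfolding mother_bouquet_def
      by (intro conjI isometric_path_unit_speed[OF iso] isometric_path_D_short[OF iso])
        (simp_all add: geod_0[OF cat0] geod_end[OF cat0] std_D_bounds)
    moreover have "canonical_bouquet y =
        restrict (\<lambda>(n, t). if t \<le> dist p x then geod p x t else x) (bouquet_index C)"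
      by (auto simp: canonical_bouquet_def Inl ideal_path_def geod_beyond[OF cat0]
          intro!: restrict_ext)
    ultimately have fin: "finite_length_bouquet C p x (canonical_bouquet y)"
      unfolding finite_length_bouquet_def by blast
    then show ?thesis
      using bouquet_proj_finite_length[OF fin] by (auto simp: generalized_bouquets_def Inl)
  next
    case (Inr \<xi>)
    then have \<xi>: "\<xi> \<in> ideal_boundary" using assms by simp
    note g = ideal_path_Inr[OF complete cat0 \<xi>, of p]
    have "cD_bouquet (2 * C + 2) std_D (ideal_path p (Inr \<xi>) 0)
        (std_L C, \<lambda>n t. canonical_bouquet y (n, t))"
    proof (rule isometric_cD_bouquet[OF g(1)])
      show "mono_on {1..} (std_L C)"
        using C by (auto simp: mono_on_def std_L_def intro!: power_increasing)
    qed (use C std_L_pos[OF C] filterlim_std_L[OF C] std_D_bounds(1)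
        in \<open>auto simp: canonical_bouquet_def Inr less_imp_le\<close>)
    then have std: "standard_bouquet C p (canonical_bouquet y)"
      using g(2) by (simp add: standard_bouquet_def as_path_seq_def canonical_bouquet_def)
    then obtain \<eta> where \<eta>: "\<eta> \<in> ideal_boundary"
      "bouquet_proj C p (canonical_bouquet y) = boundary_map (Inr \<eta>)"
      "\<forall>(n, t)\<in>bouquet_index C.
        dist (ideal_path p (Inr \<eta>) t) (canonical_bouquet y (n, t)) \<le> 4 * C + 9"
      using standard_bouquet_proj by blast
    note h = ideal_path_Inr[OF complete cat0 \<eta>(1), of p]
    \<comment> \<open>The general result provides only some boundary point \<eta>. Since its ray
      stays at bounded distance from that of \<xi>, the two points are equal.\<close>
    have "dist (ideal_path p (Inr \<eta>) t) (ideal_path p (Inr \<xi>) t) \<le> 4 * C + 9" if "0 \<le> t" for t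
    proof -
      obtain n where "1 \<le> n" "t \<le> std_L C n" using exists_std_L_ge[OF C] by blast
      then have "(n, t) \<in> bouquet_index C" using that by simp
      then show ?thesis
        using bspec[OF \<eta>(3), of "(n, t)"] by (simp add: canonical_bouquet_def Inr del: mem_bouquet_index)
    qed
    then have "(ideal_path p (Inr \<eta>), ideal_path p (Inr \<xi>)) \<in> ray_equiv"
      by (rule ray_equivI[OF h(1) g(1)])
    then have "\<eta> = \<xi>" using ray_class_eq_iff[OF h(1) g(1)] g(3) h(3) by simp
    then show ?thesis using \<eta>(2) std by (simp add: generalized_bouquets_def Inr)
  qed
  then show "canonical_bouquet y \<in> generalized_bouquets C p"
    "bouquet_proj C p (canonical_bouquet y) = boundary_map y" by blast+
qed

section \<open>Images of cone-open sets are open\<close>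

text \<open>At a parameter beyond \<open>dist p x + r + 1\<close> the bouquet rests at
  \<open>x\<close>, and any coordinate within \<open>r\<close> of \<open>x\<close> is nearer to
  \<open>p\<close> than a running path could be. The other bouquet is thus of finite length and
  shows its endpoint there.\<close>

lemma bouquets_near_finite_length:
  assumes "finite_length_bouquet C p x b" "0 < r"
  shows "\<exists>i\<in>bouquet_index C. \<exists>d>0. \<forall>b'\<in>generalized_bouquets C p.
    dist (b' i) (b i) < d \<longrightarrow> (\<exists>x'\<in>ball x r. bouquet_proj C p b' = Inl x')"
proof -
  obtain n where n: "1 \<le> n" "dist p x + r + 1 \<le> std_L C n" using exists_std_L_ge[OF C] by blast
  define T where "T = std_L C n"
  have i: "(n, T) \<in> bouquet_index C" using n std_L_pos[OF C, of n] by (simp add: T_def)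
  have bx: "b (n, T) = x"
    using finite_length_bouquet_bounds(2)[OF assms(1) i] n assms(2) by (simp add: T_def)
  have "\<exists>x'\<in>ball x r. bouquet_proj C p b' = Inl x'"
    if b': "b' \<in> generalized_bouquets C p" and near: "dist (b' (n, T)) (b (n, T)) < r" for b'
  proof -
    have lt: "dist p (b' (n, T)) < T - 1"
      using near n(2)[folded T_def] dist_triangle[of p "b' (n, T)" x]
      by (simp add: bx dist_commute)
    then have "\<not> standard_bouquet C p b'"
      using standard_bouquet_dist_start(1)[OF _ i, of p b'] by force
    then obtain x' where x': "finite_length_bouquet C p x' b'"
      using b' by (auto simp: generalized_bouquets_def)
    then show ?thesis
      using finite_length_bouquet_bounds(3)[OF x' i lt] bouquet_proj_finite_length[OF x'] near
      by (intro bexI[of _ x']) (auto simp: bx dist_commute)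
  qed
  then show ?thesis using i assms(2) by blast
qed

lemma bouquets_near_boundary_point:
  assumes b: "\<And>n t. (n, t) \<in> bouquet_index C \<Longrightarrow> dist (ideal_path p (Inr \<xi>) t) (b (n, t)) \<le> 4 * C + 9"
    and \<xi>: "\<xi> \<in> ideal_boundary" and r: "0 < r" and t: "0 < t"
  shows "\<exists>i\<in>bouquet_index C. \<exists>d>0. \<forall>b'\<in>generalized_bouquets C p.
    dist (b' i) (b i) < d \<longrightarrow> (\<exists>y\<in>cone_nbhd p \<xi> r t. bouquet_proj C p b' = boundary_map y)"
proof -
  \<comment> \<open>Two errors between path and bouquet, plus 1 for the distance of the
    coordinates.\<close>
  define N where "N = 2 * (4 * C + 9) + 1"
  \<comment> \<open>From parameter \<open>T\<close> on, a discrepancy of \<open>3 * N\<close>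
    contracts to less than \<open>r\<close> at \<open>t\<close>.\<close>
  define T where "T = max t (3 * N * t / r + 1)"
  have N: "0 < N" using C by (simp add: N_def)
  have T: "t \<le> T" "3 * N * t < r * T" "0 < T"
  proof -
    have "3 * N * t / r < T" by (simp add: T_def)
    then show "3 * N * t < r * T" using r by (simp add: pos_divide_less_eq mult_ac)
  qed (use t in \<open>auto simp: T_def\<close>)
  obtain n where n: "1 \<le> n" "T + N \<le> std_L C n" using exists_std_L_ge[OF C] by blast
  define S where "S = std_L C n"
  have i: "(n, S) \<in> bouquet_index C" using n std_L_pos[OF C, of n] by (simp add: S_def)
  have S: "T + N \<le> S" "0 \<le> S" using n T N by (auto simp: S_def)
  let ?x = "ideal_path p (Inr \<xi>)"
  have x: "Inr \<xi> \<in> ideal_space - Inl ` ball p T'" for T' using \<xi> by simp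
  have "\<exists>y\<in>cone_nbhd p \<xi> r t. bouquet_proj C p b' = boundary_map y"
    if b': "b' \<in> generalized_bouquets C p" and near: "dist (b' (n, S)) (b (n, S)) < 1" for b'
  proof -
    obtain y :: "'a + (real \<Rightarrow> 'a) set"
      where y: "y \<in> ideal_space" "bouquet_proj C p b' = boundary_map y"
      "\<And>n t. (n, t) \<in> bouquet_index C \<Longrightarrow> dist (ideal_path p y t) (b' (n, t)) \<le> 4 * C + 9"
      using generalized_bouquet_proj[OF b'] by blast
    let ?y = "ideal_path p y"
    have SN: "dist (?x S) (?y S) \<le> N"
      using b[OF i] y(3)[OF i] near dist_triangle[of "?x S" "?y S" "b (n, S)"]
        dist_triangle[of "b (n, S)" "?y S" "b' (n, S)"]
      by (simp add: N_def dist_commute)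
    \<comment> \<open>The path to \<open>y\<close> may end before \<open>S\<close>, but not before
      \<open>S - N\<close>: at \<open>S\<close> it is within \<open>N\<close> of a point at distance
      \<open>S\<close> from \<open>p\<close>. Contraction therefore starts at \<open>S - N\<close>,
      and stepping back costs \<open>N\<close> on either path.\<close>
    define T' where "T' = S - N"
    have T': "T \<le> T'" "0 < T'" using S T by (auto simp: T'_def)
    have "y \<notin> Inl ` ball p T'"
    proof
      assume "y \<in> Inl ` ball p T'"
      then obtain z where z: "y = Inl z" "dist p z < T'" by auto
      then have "?y S = z" using N by (simp add: ideal_path_def geod_beyond[OF cat0] T'_def)
      moreover have "dist p (?x S) = S"
        using isometric_path_dist[OF ideal_path_isometric[OF complete cat0 x[of S]], of 0 S]
          ideal_path_0[OF complete cat0, of "Inr \<xi>" p] x S(2) by simp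
      ultimately show False
        using SN z(2) dist_triangle[of p "?x S" z] by (simp add: dist_commute T'_def)
    qed
    then have yT': "y \<in> ideal_space - Inl ` ball p T'" using y(1) by blast
    have "dist (?x T') (?y T') \<le> 3 * N"
    proof -
      have "dist (?x S) (?x T') \<le> N" "dist (?y S) (?y T') \<le> N"
        using ideal_path_lipschitz[OF complete cat0, of "Inr \<xi>" S T' p] \<xi>
          ideal_path_lipschitz[OF complete cat0 y(1) S(2), of T' p] T' S(2) N
        by (auto simp: T'_def)
      then show ?thesis
        using SN dist_triangle[of "?x T'" "?y T'" "?x S"] dist_triangle[of "?x S" "?y T'" "?y S"]
        by (simp add: dist_commute)
    qed
    then have "dist (?x t) (?y t) \<le> t / T' * (3 * N)"
      using ideal_path_contraction[OF complete cat0 x yT', of t] t T T'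
        mult_left_mono[of "dist (?x T') (?y T')" "3 * N" "t / T'"] by simp
    also have "\<dots> < r"
    proof -
      have "3 * N * t < r * T'" using T(2) T'(1) r mult_left_mono[of T T' r] by linarith
      then show ?thesis using T'(2) by (simp add: pos_divide_less_eq mult_ac)
    qed
    finally have "dist (?x t) (?y t) < r" .
    moreover have "y \<in> ideal_space - Inl ` ball p t" using yT' T(1) T'(1) by auto
    ultimately show ?thesis
      using mem_cone_nbhd[OF complete cat0 \<xi> t] y(2) by blast
  qed
  then show ?thesis using i by (intro bexI[of _ "(n, S)"] exI[of _ 1]) auto
qed

lemma openin_boundary_map_image:
  assumes U: "openin (cone_topology p) U"
  shows "openin (bouquet_topology C p) (boundary_map ` U)"
proof -
  note U = U[unfolded openin_cone_topology[OF complete cat0]]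
  have inj: "inj_on boundary_map (ideal_space :: ('a + (real \<Rightarrow> 'a) set) set)"
    by (rule inj_on_boundary_map[OF complete cat0])
  have "\<exists>i\<in>bouquet_index C. \<exists>d>0. \<forall>b'\<in>generalized_bouquets C p.
      dist (b' i) (b i) < d \<longrightarrow> bouquet_proj C p b' \<in> boundary_map ` U"
    if b: "b \<in> generalized_bouquets C p" and proj: "bouquet_proj C p b \<in> boundary_map ` U" for b
  proof -
    obtain y where y: "y \<in> ideal_space" "bouquet_proj C p b = boundary_map y"
      "\<And>n t. (n, t) \<in> bouquet_index C \<Longrightarrow> dist (ideal_path p y t) (b (n, t)) \<le> 4 * C + 9"
      using generalized_bouquet_proj[OF b] by blast
    have yU: "y \<in> U"
      using proj inj_on_image_mem_iff[OF inj y(1) U[THEN conjunct1]] y(2) by simp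
    show ?thesis
    proof (cases y)
      case (Inl x)
      then obtain r where r: "r > 0" "Inl ` ball x r \<subseteq> U" using U yU by blast
      have "\<not> standard_bouquet C p b" using y(2) Inl by (auto simp: bouquet_proj_def)
      then obtain x' where x': "finite_length_bouquet C p x' b"
        using b by (auto simp: generalized_bouquets_def)
      have "x' = x" using bouquet_proj_finite_length[OF x'] y(2) Inl by simp
      moreover have "Inl z \<in> boundary_map ` U" if "z \<in> ball x r" for z
        using that r(2) by (intro image_eqI[of _ _ "Inl z"]) auto
      ultimately show ?thesis
        using bouquets_near_finite_length[OF x' r(1)] by (elim bexE exE conjE) (metis (no_types))
    next
      case (Inr \<xi>)
      then obtain r t where rt: "0 < r" "0 < t" "cone_nbhd p \<xi> r t \<subseteq> U" using U yU by blast
      have \<xi>: "\<xi> \<in> ideal_boundary" using y(1) Inr by simp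
      have "\<exists>i\<in>bouquet_index C. \<exists>d>0. \<forall>b'\<in>generalized_bouquets C p.
          dist (b' i) (b i) < d \<longrightarrow> (\<exists>y\<in>cone_nbhd p \<xi> r t. bouquet_proj C p b' = boundary_map y)"
        by (rule bouquets_near_boundary_point[OF _ \<xi> rt(1,2)]) (rule y(3)[unfolded Inr])
      moreover have "z \<in> boundary_map ` U" if "\<exists>y\<in>cone_nbhd p \<xi> r t. z = boundary_map y" for z
        using that rt(3) by blast
      ultimately show ?thesis by meson
    qed
  qed
  then show ?thesis
    using U unfolding openin_bouquet_topology_image[OF U[THEN conjunct1]]
    by (intro openin_generalized_bouquetsI) auto
qed

section \<open>Preimages of bouquet-open sets are open\<close>

text \<open>Openness of the preimage is exploited at the canonical bouquet of \<open>y\<close>.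
  Finitely many coordinates involve only parameters up to some \<open>T\<close>, so paths that are
  uniformly close on \<open>[0, T]\<close> belong to points of \<open>U\<close>.\<close>

lemma openin_of_boundary_map_image:
  assumes US: "U \<subseteq> ideal_space" and open_image: "openin (bouquet_topology C p) (boundary_map ` U)"
  shows "openin (cone_topology p) U"
proof -
  have inj: "inj_on boundary_map (ideal_space :: ('a + (real \<Rightarrow> 'a) set) set)"
    by (rule inj_on_boundary_map[OF complete cat0])
  have *: "\<exists>T d. 0 < T \<and> 0 < d \<and> (\<forall>z\<in>ideal_space.
      (\<forall>t. 0 \<le> t \<and> t \<le> T \<longrightarrow> dist (ideal_path p z t) (ideal_path p y t) < d) \<longrightarrow> z \<in> U)"
    if y: "y \<in> U" for y
  proof -
    let ?S = "{b \<in> generalized_bouquets C p. bouquet_proj C p b \<in> boundary_map ` U}"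
    have "canonical_bouquet y \<in> ?S"
      using canonical_bouquet[OF subsetD[OF US y]] y by simp
    from openin_generalized_bouquetsD[OF open_image[unfolded openin_bouquet_topology_image[OF US]] this]
    obtain J d where J: "finite J" "J \<subseteq> bouquet_index C" "0 < d" and
      Jd: "\<forall>b\<in>generalized_bouquets C p. (\<forall>i\<in>J. dist (b i) (canonical_bouquet y i) < d) \<longrightarrow> b \<in> ?S"
      by (elim exE conjE) (rule that)
    define T where "T = Max (insert 1 (snd ` J))"
    have T: "0 < T" "\<And>n t. (n, t) \<in> J \<Longrightarrow> t \<le> T"
    proof -
      have "1 \<le> T" unfolding T_def using J(1) by (intro Max_ge) auto
      then show "0 < T" by simp
      show "t \<le> T" if "(n, t) \<in> J" for n t
        unfolding T_def using J(1) that by (intro Max_ge) force+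
    qed
    have "z \<in> U" if z: "z \<in> ideal_space"
      "\<forall>t. 0 \<le> t \<and> t \<le> T \<longrightarrow> dist (ideal_path p z t) (ideal_path p y t) < d" for z
    proof -
      have "dist (canonical_bouquet z i) (canonical_bouquet y i) < d" if "i \<in> J" for i
      proof -
        obtain n t where i: "i = (n, t)" by fastforce
        then have "(n, t) \<in> bouquet_index C" "t \<le> T" using that J(2) T(2) by auto
        then show ?thesis using z(2) by (simp add: i canonical_bouquet_def)
      qed
      then have "boundary_map z \<in> boundary_map ` U"
        using bspec[OF Jd canonical_bouquet(1)[OF z(1)]] canonical_bouquet(2)[OF z(1)] by simp
      then show ?thesis using inj_on_image_mem_iff[OF inj z(1) US] by simp
    qed
    then show ?thesis using T(1) J(3) by (intro exI[of _ T] exI[of _ d]) simp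
  qed
  have "\<exists>r>0. Inl ` ball x r \<subseteq> U" if x: "Inl x \<in> U" for x
  proof -
    obtain T d where d: "0 < T" "0 < d" "\<forall>z\<in>ideal_space. (\<forall>t. 0 \<le> t \<and> t \<le> T \<longrightarrow>
        dist (ideal_path p z t) (ideal_path p (Inl x) t) < d) \<longrightarrow> z \<in> U"
      using *[OF x] by (elim exE conjE) (rule that)
    \<comment> \<open>The radius is halved because \<open>geod_dist_le\<close> doubles
      distances.\<close>
    have "Inl z \<in> U" if "z \<in> ball x (d / 2)" for z
    proof (rule d(3)[rule_format])
      fix t :: real assume "0 \<le> t \<and> t \<le> T"
      then show "dist (ideal_path p (Inl z) t) (ideal_path p (Inl x) t) < d"
        using geod_dist_le[OF cat0, of t p z x] that by (simp add: ideal_path_def dist_commute)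
    qed simp
    then show ?thesis using d(2) by (intro exI[of _ "d / 2"]) auto
  qed
  moreover have "\<exists>r>0. \<exists>t>0. cone_nbhd p \<xi> r t \<subseteq> U" if \<xi>: "Inr \<xi> \<in> U" for \<xi>
  proof -
    obtain T d where Td: "0 < T" "0 < d" and d: "\<forall>z\<in>ideal_space. (\<forall>t. 0 \<le> t \<and> t \<le> T \<longrightarrow>
        dist (ideal_path p z t) (ideal_path p (Inr \<xi>) t) < d) \<longrightarrow> z \<in> U"
      using *[OF \<xi>] by (elim exE conjE) (rule that)
    have \<xi>': "\<xi> \<in> ideal_boundary" using \<xi> US by auto
    \<comment> \<open>Closeness at the single parameter \<open>T\<close> gives closeness on all of
      \<open>[0, T]\<close> by contraction.\<close>
    have "z \<in> U" if z: "z \<in> cone_nbhd p \<xi> d T" for z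
    proof (rule d[rule_format])
      have z: "z \<in> ideal_space - Inl ` ball p T"
        "dist (ideal_path p (Inr \<xi>) T) (ideal_path p z T) < d"
        using z mem_cone_nbhd[OF complete cat0 \<xi>' Td(1)] by auto
      then show "z \<in> ideal_space" by blast
      fix t assume "0 \<le> t \<and> t \<le> T"
      then have t: "0 \<le> t" "t \<le> T" by blast+
      have "dist (ideal_path p (Inr \<xi>) t) (ideal_path p z t) \<le>
          dist (ideal_path p (Inr \<xi>) T) (ideal_path p z T)"
        using \<xi>' by (intro ideal_path_contraction_le[OF complete cat0 _ z(1) t Td(1)]) auto
      then show "dist (ideal_path p z t) (ideal_path p (Inr \<xi>) t) < d"
        using z(2) by (simp add: dist_commute)
    qed
    then show ?thesis using Td by blast
  qed
  ultimately show ?thesis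
    unfolding openin_cone_topology[OF complete cat0] using US by blast
qed

lemma homeomorphic_map_boundary_map:
  "homeomorphic_map (cone_topology p) (bouquet_topology C p) boundary_map"
proof (rule bijective_open_imp_homeomorphic_map)
  note tops = topspace_cone_topology[OF complete cat0] topspace_bouquet_topology
  note surj = boundary_map_surj[OF complete cat0]
  show "continuous_map (cone_topology p) (bouquet_topology C p) boundary_map"
    unfolding continuous_map_def tops
  proof (intro conjI allI impI)
    show "boundary_map \<in> ideal_space \<rightarrow> (bouquet_space :: ('a + 'a path_seq set) set)"
      using surj by blast
    fix V assume V: "openin (bouquet_topology C p) V"
    have "V \<subseteq> boundary_map ` ideal_space"
      using openin_subset[OF V] tops(2) surj by simp
    then have "boundary_map ` {y \<in> ideal_space. boundary_map y \<in> V} = V" by blast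
    then show "openin (cone_topology p) {y \<in> ideal_space. boundary_map y \<in> V}"
      using V by (intro openin_of_boundary_map_image) auto
  qed
  show "open_map (cone_topology p) (bouquet_topology C p) boundary_map"
    unfolding open_map_def using openin_boundary_map_image by blast
  show "boundary_map ` topspace (cone_topology p) = topspace (bouquet_topology C p)"
    using surj tops by simp
  show "inj_on boundary_map (topspace (cone_topology p))"
    using inj_on_boundary_map[OF complete cat0] tops by simp
qed

end

end

theorem theorem1p1:
  fixes x0 :: "'a::metric_space" and C :: real
  assumes "complete (UNIV :: 'a set)"
    and "CAT0 TYPE('a)"
    and "C > 0" and "rCAT0 C TYPE('a)"
  shows "\<exists>f :: 'a + (real \<Rightarrow> 'a) set \<Rightarrow> 'a + 'a path_seq set.
           homeomorphic_map (cone_topology x0) (bouquet_topology C x0) f \<and>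
           (\<forall>x. f (Inl x) = Inl x) \<and>
           (\<forall>g. geodesic_ray g \<longrightarrow>
              f (Inr (ray_class g)) =
                Inr (bouquet_class (\<lambda>n. real n, \<lambda>n. restrict g {0..real n})))"
proof (intro exI conjI allI impI)
  show "homeomorphic_map (cone_topology x0) (bouquet_topology C x0) boundary_map"
    by (rule homeomorphic_map_boundary_map[OF assms(3,1,2)])
  show "boundary_map (Inl x) = Inl x" for x :: 'a
    by simp
  show "boundary_map (Inr (ray_class g)) =
      Inr (bouquet_class (\<lambda>n. real n, \<lambda>n. restrict g {0..real n}))"
    if "geodesic_ray g" for g :: "real \<Rightarrow> 'a"
    using boundary_map_ray_class[OF that] by (simp only: ray_bouquet_def)
qed

end
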